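(* Let $A_i:\mathcal H\rightrightarrows\mathcal H$ be maximal $\sigma_i$-monotone ($\sigma_i\in\mathbb R$) for each $i=1,\dots,m$, and assume $\operatorname{zer}(A_1+\cdots+A_m)\neq\emptyset$. Let $\mu\in(0,2)$ and $\lambda_1,\dots,\lambda_{m-1}\in(0,+\infty)$ with $\sum_{i=1}^{m-1}\lambda_i=1$. Suppose that one of the following holds: (A) (Nonmonotone case) there exists $j\in\{1,\dots,m\}$ such that $\sigma_j<0$, $\sigma_m\neq0$, $\sum_{i=1}^m\sigma_i>0$, and $\bar\lambda^*$ is the optimal value of the maximization problem (P) described in the context; (B) (Monotone case) $\sigma_i\ge 0$ for all $i=1,\dots,m$, and $\bar\lambda^*=+\infty$. Let $\lambda\in(0,\bar\lambda^* )$ and let $\{(\mathbf x^k,\mathbf z^k,\mathbf y^k)\}_{k\ge0}$ be generated from an arbitrary initial point $\mathbf x^0\in\mathcal H^{m-1}$ by $$\mathbf z^k\in J^{\boldsymbol\Lambda}_{\lambda\mathbf F}(\mathbf x^k),\qquad \mathbf y^k\in J^{\boldsymbol\Lambda}_{\lambda\mathbf G}(2\mathbf z^k-\mathbf x^k),\qquad \mathbf x^{k+1}=\mathbf x^k+\mu(\mathbf y^k-\mathbf z^k).$$ Then: (i) there exists $\bar{\mathbf x}\in\operatorname{Fix}(T_{\mathbf F,\mathbf G})$ such that $\mathbf x^k\rightharpoonup\bar{\mathbf x}$ and $\bar{\mathbf z}:=J^{\boldsymbol\Lambda}_{\lambda\mathbf F}(\bar{\mathbf x})\in\boldsymbol\Delta_{m-1}\big(\operatorname{zer}(\sum_{i=1}^mA_i)\big)$;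 (ii) $\|(\mathbf{Id}-T_{\mathbf F,\mathbf G})\mathbf x^k\|=o(1/\sqrt k)$ as $k\to\infty$; (iii) $\|\mathbf y^{k+1}-\mathbf y^k\|=o(1/\sqrt k)$ and $\|\mathbf z^{k+1}-\mathbf z^k\|=o(1/\sqrt k)$ as $k\to\infty$. Moreover: (iv) if either (A) holds, or (B) holds and there exists $j\in\{1,\dots,m\}$ with $\sigma_j>0$, then $\mathbf z^k\to\bar{\mathbf z}$, $\mathbf y^k\to\bar{\mathbf z}$ (strongly), and $\operatorname{zer}(\sum_{i=1}^mA_i)=\{U(\bar{\mathbf x})\}$; (v) if (B) holds with $\sigma_i=0$ for all $i=1,\dots,m$, then $\mathbf z^k\rightharpoonup\bar{\mathbf z}$ and $\mathbf y^k\rightharpoonup\bar{\mathbf z}$.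
   Context: $\mathcal H$ is a real Hilbert space and $m\ge2$. $\to$ and $\rightharpoonup$ denote strong and weak convergence. For a set-valued operator $A:\mathcal H\rightrightarrows\mathcal H$: $\operatorname{gra}A=\{(x,u):u\in A(x)\}$, $\operatorname{zer}A=\{x:0\in A(x)\}$, $\operatorname{Fix}A=\{x:x\in A(x)\}$; $A$ is $\sigma$-monotone if $\langle x-y,u-v\rangle\ge\sigma\|x-y\|^2$ for all $(x,u),(y,v)\in\operatorname{gra}A$, and maximal $\sigma$-monotone if moreover no $\sigma$-monotone operator has a graph properly containing $\operatorname{gra}A$. For $\gamma>0$, $J_{\gamma A}=(\mathrm{Id}+\gamma A)^{-1}$ and $R_{\gamma A}=2J_{\gamma A}-\mathrm{Id}$. $\mathcal H^{m-1}$ has inner product $\langle\mathbf x,\mathbf y\rangle=\sum_{i=1}^{m-1}\langle x_i,y_i\rangle$. $\mathbf D_{m-1}=\{\mathbf x\in\mathcal H^{m-1}:x_1=\cdots=x_{m-1}\}$ with normal cone $N_{\mathbf D_{m-1}}(\mathbf x)=\{\mathbf w:\sum_{i}w_i=0\}$ if $\mathbf x\in\mathbf D_{m-1}$ and $\emptyset$ otherwise. $\boldsymbol\Delta_{m-1}(x)=(x,\dots,x)\in\mathcal H^{m-1}$. $\boldsymbol\Lambda(\mathbf x)=(\lambda_1x_1,\dots,\lambda_{m-1}x_{m-1})$. Define $\mathbf F(\mathbf x)=A_1(x_1)\times\cdots\times A_{m-1}(x_{m-1})$; $\mathbf K(\mathbf x)=\{(\lambda_1v,\dots,\lambda_{m-1}v):v\in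 A_m(x_1)\}$ if $\mathbf x\in\mathbf D_{m-1}$, $\mathbf K(\mathbf x)=\emptyset$ otherwise; $\mathbf G=\mathbf K+N_{\mathbf D_{m-1}}$. The $\boldsymbol\Lambda$-warped resolvent is $J^{\boldsymbol\Lambda}_{\lambda\mathbf A}=(\mathbf{Id}+\lambda\boldsymbol\Lambda^{-1}\circ\mathbf A)^{-1}$. The Douglas–Rachford operator is $T_{\mathbf F,\mathbf G}(\mathbf x)=\{\mathbf x+\mu(\mathbf y-\mathbf z):\mathbf z\in J^{\boldsymbol\Lambda}_{\lambda\mathbf F}(\mathbf x),\ \mathbf y\in J^{\boldsymbol\Lambda}_{\lambda\mathbf G}(2\mathbf z-\mathbf x)\}$. Also $U(\mathbf x)=J_{\lambda A_m}\big(\sum_{i=1}^{m-1}\lambda_iR_{\frac{\lambda}{\lambda_i}A_i}(x_i)\big)$. Under the hypotheses the operators $J^{\boldsymbol\Lambda}_{\lambda\mathbf F}$, $J^{\boldsymbol\Lambda}_{\lambda\mathbf G}$, $T_{\mathbf F,\mathbf G}$, $U$ are single-valued and everywhere defined, and singletons are identified with their elements. Problem (P): let $\mathcal I=\{i\in\{1,\dots,m-1\}:\sigma_i\ne0\}$. Maximize $\bar\lambda\ge0$ over $\delta=(\delta_i)_{i\in\mathcal I}\in\mathbb R^{|\mathcal I|}$ and $\bar\lambda\geq 0$ subject to $\sum_{i\in\mathcal I}\delta_i=1$, $\sigma_i+\sigma_m\delta_i\ge0$ for all $i\in\mathcal I$, and $$1+\frac{\bar\lambda}{\lambda_i}\,\frac{\sigma_i\sigma_m\delta_i}{\sigma_i+\sigma_m\delta_i}-\frac\mu2\ge0\quad\text{for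 all }i\in\mathcal I,$$ where, if $\sigma_i+\sigma_m\delta_i=0$, the last constraint is understood to hold only for $\bar\lambda=0$. *)

theory Defs
  imports "HOL-Analysis.Analysis" "HOL-Library.Landau_Symbols" "HOL-Library.Set_Algebras"
begin

text \<open>
  A real Hilbert space is a type of class \<open>{real_inner, complete_space}\<close>. The coordinates
  \<open>1, \<dots>, m - 1\<close> are the elements of a finite type \<open>'n\<close>, so that the product space is \<open>'a ^ 'n\<close> (with
  its library inner product, the sum of the inner products of the coordinates) and \<open>m \<ge> 2\<close> is
  automatic. The indices \<open>1, \<dots>, m\<close> are the elements of \<open>'n option\<close>, where \<open>None\<close> is the index \<open>m\<close>.
  The weights \<open>\<lambda>\<^sub>i\<close> are written \<open>\<omega> i\<close> and the step size \<open>\<lambda>\<close> is written \<open>\<gamma>\<close>.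
  Sums of sets are Minkowski sums.
\<close>

type_synonym 'a operator = "'a \<Rightarrow> 'a set"

definition gra :: "'a operator \<Rightarrow> ('a \<times> 'a) set" where
  "gra A = {(x, u). u \<in> A x}"

definition zer :: "'a::zero operator \<Rightarrow> 'a set" where
  "zer A = {x. 0 \<in> A x}"

definition Fix :: "'a operator \<Rightarrow> 'a set" where
  "Fix A = {x. x \<in> A x}"

definition op_inverse :: "'a operator \<Rightarrow> 'a operator" where
  "op_inverse A = (\<lambda>u. {x. u \<in> A x})"

definition monotone_op :: "real \<Rightarrow> 'a::real_inner operator \<Rightarrow> bool" where
  "monotone_op \<sigma> A \<longleftrightarrow>
     (\<forall>(x, u) \<in> gra A. \<forall>(y, v) \<in> gra A. (x - y) \<bullet> (u - v) \<ge> \<sigma> * (norm (x - y))\<^sup>2)"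

definition maximal_monotone_op :: "real \<Rightarrow> 'a::real_inner operator \<Rightarrow> bool" where
  "maximal_monotone_op \<sigma> A \<longleftrightarrow>
     monotone_op \<sigma> A \<and> \<not> (\<exists>B. monotone_op \<sigma> B \<and> gra A \<subset> gra B)"

definition resolvent :: "real \<Rightarrow> 'a::real_vector operator \<Rightarrow> 'a operator" where
  "resolvent \<gamma> A = op_inverse (\<lambda>x. {x + \<gamma> *\<^sub>R u |u. u \<in> A x})"

definition reflected_resolvent :: "real \<Rightarrow> 'a::real_vector operator \<Rightarrow> 'a operator" where
  "reflected_resolvent \<gamma> A = (\<lambda>x. {2 *\<^sub>R z - x |z. z \<in> resolvent \<gamma> A x})"

definition warped_resolvent ::
    "('a \<Rightarrow> 'a) \<Rightarrow> real \<Rightarrow> 'a::real_vector operator \<Rightarrow> 'a operator" where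
  "warped_resolvent L \<gamma> A = resolvent \<gamma> (\<lambda>x. inv L ` A x)"

definition weakly_tendsto :: "(nat \<Rightarrow> 'a::real_inner) \<Rightarrow> 'a \<Rightarrow> bool" where
  "weakly_tendsto x l \<longleftrightarrow> (\<forall>u. (\<lambda>k. x k \<bullet> u) \<longlonglongrightarrow> l \<bullet> u)"


subsection \<open>Product space reformulation\<close>

definition diag :: "'a \<Rightarrow> 'a ^ 'n" where
  "diag x = (\<chi> i. x)"

definition normal_cone_diag :: "('a::real_inner ^ 'n::finite) operator" where
  "normal_cone_diag x = (if x \<in> range diag then {w. (\<Sum>i\<in>UNIV. w $ i) = 0} else {})"

definition weight_map :: "('n \<Rightarrow> real) \<Rightarrow> 'a::real_vector ^ 'n \<Rightarrow> 'a ^ 'n" where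
  "weight_map \<omega> x = (\<chi> i. \<omega> i *\<^sub>R x $ i)"

definition F_op :: "('n option \<Rightarrow> 'a operator) \<Rightarrow> ('a ^ 'n) operator" where
  "F_op A x = {u. \<forall>i. u $ i \<in> A (Some i) (x $ i)}"

definition K_op ::
    "('n option \<Rightarrow> 'a::real_vector operator) \<Rightarrow> ('n \<Rightarrow> real) \<Rightarrow> ('a ^ 'n) operator" where
  "K_op A \<omega> x = {(\<chi> i. \<omega> i *\<^sub>R v) |v y. x = diag y \<and> v \<in> A None y}"

definition G_op ::
    "('n::finite option \<Rightarrow> 'a::real_inner operator) \<Rightarrow> ('n \<Rightarrow> real) \<Rightarrow> ('a ^ 'n) operator" where
  "G_op A \<omega> x = K_op A \<omega> x + normal_cone_diag x"

definition J_F ::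
    "('n::finite option \<Rightarrow> 'a::real_inner operator) \<Rightarrow> ('n \<Rightarrow> real) \<Rightarrow> real \<Rightarrow> ('a ^ 'n) operator" where
  "J_F A \<omega> \<gamma> = warped_resolvent (weight_map \<omega>) \<gamma> (F_op A)"

definition J_G ::
    "('n::finite option \<Rightarrow> 'a::real_inner operator) \<Rightarrow> ('n \<Rightarrow> real) \<Rightarrow> real \<Rightarrow> ('a ^ 'n) operator" where
  "J_G A \<omega> \<gamma> = warped_resolvent (weight_map \<omega>) \<gamma> (G_op A \<omega>)"

definition DR_op ::
    "('n::finite option \<Rightarrow> 'a::real_inner operator) \<Rightarrow> ('n \<Rightarrow> real) \<Rightarrow> real \<Rightarrow> real
      \<Rightarrow> ('a ^ 'n) operator" where
  "DR_op A \<omega> \<gamma> \<mu> x =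
     {x + \<mu> *\<^sub>R (y - z) |y z. z \<in> J_F A \<omega> \<gamma> x \<and> y \<in> J_G A \<omega> \<gamma> (2 *\<^sub>R z - x)}"

definition U_op ::
    "('n::finite option \<Rightarrow> 'a::real_inner operator) \<Rightarrow> ('n \<Rightarrow> real) \<Rightarrow> real
      \<Rightarrow> 'a ^ 'n \<Rightarrow> 'a set" where
  "U_op A \<omega> \<gamma> x =
     (\<Union>s \<in> (\<Sum>i\<in>UNIV. (*\<^sub>R) (\<omega> i) ` reflected_resolvent (\<gamma> / \<omega> i) (A (Some i)) (x $ i)).
        resolvent \<gamma> (A None) s)"


subsection \<open>Step size bound\<close>

text \<open>
  Only the values of \<open>\<delta>\<close> on the set of \<open>i\<close> with \<open>\<sigma> (Some i) \<noteq> 0\<close> are constrained. The case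
  distinction is needed because \<open>x / 0 = 0\<close> in HOL.
\<close>

definition feasible ::
    "('n::finite option \<Rightarrow> real) \<Rightarrow> ('n \<Rightarrow> real) \<Rightarrow> real \<Rightarrow> ('n \<Rightarrow> real) \<Rightarrow> real \<Rightarrow> bool" where
  "feasible \<sigma> \<omega> \<mu> \<delta> b \<longleftrightarrow>
     (let I = {i. \<sigma> (Some i) \<noteq> 0} in
        b \<ge> 0 \<and> (\<Sum>i\<in>I. \<delta> i) = 1 \<and>
        (\<forall>i\<in>I. \<sigma> (Some i) + \<sigma> None * \<delta> i \<ge> 0) \<and>
        (\<forall>i\<in>I. if \<sigma> (Some i) + \<sigma> None * \<delta> i = 0 then b = 0
               else 1 + b / \<omega> i *
                      (\<sigma> (Some i) * \<sigma> None * \<delta> i / (\<sigma> (Some i) + \<sigma> None * \<delta> i))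
                    - \<mu> / 2 \<ge> 0))"

definition optimal_value ::
    "('n::finite option \<Rightarrow> real) \<Rightarrow> ('n \<Rightarrow> real) \<Rightarrow> real \<Rightarrow> ereal" where
  "optimal_value \<sigma> \<omega> \<mu> = Sup {ereal b |b. \<exists>\<delta>. feasible \<sigma> \<omega> \<mu> \<delta> b}"

definition nonmonotone_case ::
    "('n::finite option \<Rightarrow> real) \<Rightarrow> ('n \<Rightarrow> real) \<Rightarrow> real \<Rightarrow> ereal \<Rightarrow> bool" where
  "nonmonotone_case \<sigma> \<omega> \<mu> bound \<longleftrightarrow>
     (\<exists>j. \<sigma> j < 0) \<and> \<sigma> None \<noteq> 0 \<and> (\<Sum>i\<in>UNIV. \<sigma> i) > 0 \<and> bound = optimal_value \<sigma> \<omega> \<mu>"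

definition monotone_case :: "('n::finite option \<Rightarrow> real) \<Rightarrow> ereal \<Rightarrow> bool" where
  "monotone_case \<sigma> bound \<longleftrightarrow> (\<forall>i. \<sigma> i \<ge> 0) \<and> bound = \<infinity>"

end

theory Submission
  imports Defs "HOL-Library.Diagonal_Subsequence"
begin

text \<open>
  One step of the iteration is encoded by a point \<open>p\<close> and graph elements \<open>u\<^sub>j\<close> with
  \<open>u\<^sub>i \<in> A\<^sub>i(z\<^sub>i)\<close>, \<open>x\<^sub>i = z\<^sub>i + (\<gamma>/\<omega>\<^sub>i)u\<^sub>i\<close>, \<open>u\<^sub>m \<in> A\<^sub>m(p)\<close>, \<open>p + \<gamma>u\<^sub>m = \<Sum>\<^sub>i \<omega>\<^sub>i(2z\<^sub>i - x\<^sub>i)\<close> and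
  \<open>y = (p, \<dots>, p)\<close>. This is a \<open>splitting\<close> of \<open>x\<close>. In the squared norm \<open>\<Sum>\<^sub>i \<omega>\<^sub>i\<parallel>x\<^sub>i\<parallel>\<^sup>2\<close> an algebraic identity
  (\<open>DR_identity\<close>) expresses the decrease of the distance between two steps through the monotonicity
  products \<open>\<langle>z\<^sub>i - z'\<^sub>i, u\<^sub>i - u'\<^sub>i\<rangle>\<close> and \<open>\<langle>p - p', u\<^sub>m - u'\<^sub>m\<rangle>\<close>, which are bounded below by
  \<open>\<sigma>\<^sub>i\<parallel>z\<^sub>i - z'\<^sub>i\<parallel>\<^sup>2\<close> and \<open>\<sigma>\<^sub>m\<parallel>p - p'\<parallel>\<^sup>2\<close>.

  Some of these bounds may be negative. The modulus \<open>\<sigma>\<^sub>m\<close> is therefore shared out among the other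
  operators, \<open>\<sigma>\<^sub>m = \<Sum>\<^sub>i s\<^sub>i\<close>, and
  \<open>s\<parallel>p\<parallel>\<^sup>2 + \<sigma>\<parallel>z\<parallel>\<^sup>2 = \<sigma>s/(\<sigma>+s) \<parallel>p - z\<parallel>\<^sup>2 + \<parallel>\<sigma>z + sp\<parallel>\<^sup>2/(\<sigma>+s)\<close>
  leaves only a multiple of \<open>\<parallel>p - z\<parallel>\<^sup>2\<close>, which the term \<open>(1 - \<mu>/2)\<omega>\<^sub>i\<parallel>p - z\<parallel>\<^sup>2\<close> of the relaxation
  compensates when the constraints of the step size problem hold with strict inequality.
  The result is \<open>averaged\<close>: a step decreases the squared distance by at least \<open>2\<mu>\<kappa>\<close> times the squared
  distance of the residuals plus \<open>2\<mu>\<tau>\<parallel>p - p'\<parallel>\<^sup>2\<close>, with \<open>\<kappa> > 0\<close>, and \<open>\<tau> > 0\<close> unless all moduli vanish.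

  Compared with a fixed point, this makes \<open>x\<^sup>k\<close> Fejer monotone, the squared residuals
  summable, and, if \<open>\<tau> > 0\<close>, \<open>p\<^sup>k\<close> strongly convergent to the unique zero. Compared with the
  next step, it makes the residuals decrease; a decreasing summable sequence is \<open>o(1/k)\<close>, so
  the residual is \<open>o(1/\<surd>k)\<close>, and the increments of \<open>z\<close> and \<open>y\<close> inherit the rate because \<open>z\<close>
  and \<open>y\<close> are Lipschitz functions of \<open>x\<close>. Weak convergence follows from Opial's argument once
  weak cluster points are known to be fixed points. That is \<open>product_demiclosed\<close>: it passes
  to the limit in the sum of all monotonicity inequalities, whose duality products converge
  even though the single ones need not, and then uses maximality of each operator separately.
\<close>

section \<open>Weak convergence in Hilbert spaces\<close>

text \<open>
  The representing vector is the minimizer over \<open>S\<close> of \<open>\<parallel>u\<parallel>\<^sup>2 - 2 L(u)\<close>. The parallelogram identity makes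
  minimizing sequences Cauchy, and the first variation at the minimizer is the representation.
  With \<open>L = \<langle>u, \<cdot>\<rangle>\<close> the lemma yields the orthogonal projection of \<open>u\<close> onto \<open>S\<close>.
\<close>

lemma riesz_on_closed_subspace:
  fixes S :: "'a::{real_inner, complete_space} set" and L :: "'a \<Rightarrow> real"
  assumes S: "subspace S" "closed S"
    and add: "\<And>u w. u \<in> S \<Longrightarrow> w \<in> S \<Longrightarrow> L (u + w) = L u + L w"
    and scale: "\<And>c u. u \<in> S \<Longrightarrow> L (c *\<^sub>R u) = c * L u"
    and bound: "\<And>u. u \<in> S \<Longrightarrow> \<bar>L u\<bar> \<le> B * norm u"
  obtains r where "r \<in> S" "\<And>w. w \<in> S \<Longrightarrow> L w = r \<bullet> w"
proof -
  define \<phi> where "\<phi> u = u \<bullet> u - 2 * L u" for u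
  define m where "m = (INF u\<in>S. \<phi> u)"
  have lower: "- (B\<^sup>2) \<le> \<phi> u" if "u \<in> S" for u
  proof -
    have "0 \<le> (norm u - B)\<^sup>2" by simp
    moreover have "L u \<le> B * norm u" using bound[OF that] by linarith
    ultimately show ?thesis
      by (simp add: \<phi>_def power2_diff dot_square_norm mult.commute)
  qed
  have bdd: "bdd_below (\<phi> ` S)" using lower by (auto intro!: bdd_belowI2)
  have m_le: "m \<le> \<phi> u" if "u \<in> S" for u
    unfolding m_def using bdd that by (rule cINF_lower)
  have S0: "S \<noteq> {}" using subspace_0[OF S(1)] by auto
  have "\<exists>u\<in>S. \<phi> u < m + 1 / real (Suc n)" for n
    using cINF_less_iff[OF S0 bdd, of "m + 1 / real (Suc n)"] by (simp add: m_def)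
  then obtain w where wS: "\<And>n. w n \<in> S" and w: "\<And>n. \<phi> (w n) < m + 1 / real (Suc n)"
    by metis
  have parallelogram: "(norm (a - b))\<^sup>2 \<le> 2 * (\<phi> a - m) + 2 * (\<phi> b - m)" if "a \<in> S" "b \<in> S" for a b
  proof -
    have mid: "(1/2) *\<^sub>R (a + b) \<in> S"
      using that S(1) by (simp add: subspace_add subspace_scale)
    have "L ((1/2) *\<^sub>R (a + b)) = (L a + L b) / 2"
      using that S(1) by (simp only: scale[OF subspace_add] add)
    then have "4 * \<phi> ((1/2) *\<^sub>R (a + b)) = 2 * \<phi> a + 2 * \<phi> b - (norm (a - b))\<^sup>2"
      by (simp add: \<phi>_def power2_norm_eq_inner algebra_simps inner_commute)
    with m_le[OF mid] show ?thesis by simp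
  qed
  have "Cauchy w"
  proof (rule CauchyI)
    fix e :: real assume "0 < e"
    then obtain N where N: "inverse (real (Suc N)) < e\<^sup>2 / 4"
      using reals_Archimedean[of "e\<^sup>2 / 4"] by auto
    have "norm (w i - w j) < e" if "i \<ge> N" "j \<ge> N" for i j
    proof -
      have *: "4 * (\<phi> (w k) - m) < e\<^sup>2" if "k \<ge> N" for k
      proof -
        have "1 / real (Suc k) \<le> inverse (real (Suc N))"
          using that by (simp add: field_simps)
        with N w[of k] have "\<phi> (w k) - m < e\<^sup>2 / 4" by linarith
        then show ?thesis by simp
      qed
      have "(norm (w i - w j))\<^sup>2 < e\<^sup>2"
        using parallelogram[OF wS wS, of i j] *[OF that(1)] *[OF that(2)]
        unfolding right_diff_distrib by linarith
      then show ?thesis using \<open>0 < e\<close> by (simp add: power2_less_imp_less)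
    qed
    then show "\<exists>N. \<forall>i\<ge>N. \<forall>j\<ge>N. norm (w i - w j) < e" by blast
  qed
  then obtain r where r: "w \<longlonglongrightarrow> r" using Cauchy_convergent convergent_def by blast
  have rS: "r \<in> S" using closed_sequentially[OF S(2) wS r] .
  have "(\<lambda>n. L (w n)) \<longlonglongrightarrow> L r"
  proof (rule LIM_zero_cancel, rule Lim_null_comparison)
    have "L (w n) - L r = L (w n - r)" for n
      using add[OF wS subspace_scale[OF S(1) rS], of n "-1"] scale[OF rS, of "-1"] by simp
    then show "\<forall>\<^sub>F n in sequentially. norm (L (w n) - L r) \<le> B * norm (w n - r)"
      using bound[OF subspace_diff[OF S(1) wS rS]] by simp
    show "(\<lambda>n. B * norm (w n - r)) \<longlonglongrightarrow> 0"
      using r by (auto intro!: tendsto_eq_intros simp: LIM_zero_iff)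
  qed
  then have "(\<lambda>n. \<phi> (w n)) \<longlonglongrightarrow> \<phi> r"
    unfolding \<phi>_def using r by (intro tendsto_intros)
  moreover have "(\<lambda>n. m + 1 / real (Suc n)) \<longlonglongrightarrow> m + 0"
    using LIMSEQ_inverse_real_of_nat by (intro tendsto_intros) (simp add: inverse_eq_divide)
  ultimately have "\<phi> r \<le> m + 0"
    by (rule LIMSEQ_le) (blast intro: w less_imp_le)
  then have min: "\<phi> r \<le> m" by simp
  have "L u = r \<bullet> u" if u: "u \<in> S" for u
  proof -
    define c where "c = r \<bullet> u - L u"
    \<comment> \<open>For \<open>c \<noteq> 0\<close> this step would make \<open>\<phi>\<close> smaller than its infimum.\<close>
    define t where "t = - c / (u \<bullet> u + 1)"
    have pos: "u \<bullet> u + 1 > 0" using inner_ge_zero[of u] by linarith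
    have "m \<le> \<phi> (r + t *\<^sub>R u)"
      using rS u S(1) by (intro m_le subspace_add subspace_scale)
    also have "\<phi> (r + t *\<^sub>R u) = \<phi> r + 2 * t * c + t\<^sup>2 * (u \<bullet> u)"
      using add[OF rS subspace_scale[OF S(1) u, of t]] scale[OF u, of t]
      by (simp add: \<phi>_def c_def algebra_simps inner_commute power2_eq_square)
    finally have "0 \<le> 2 * t * c + t\<^sup>2 * (u \<bullet> u)" using min by linarith
    moreover have "c = - t * (u \<bullet> u + 1)" using pos by (simp add: t_def)
    ultimately have "0 \<le> - (t\<^sup>2 * (u \<bullet> u + 2))"
      by (simp add: power2_eq_square algebra_simps)
    moreover have "u \<bullet> u + 2 > 0" using pos by linarith
    ultimately have "t\<^sup>2 \<le> 0" by (simp add: mult_le_0_iff)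
    then have "t = 0" by simp
    then have "c = 0" using pos by (simp add: t_def)
    then show ?thesis by (simp add: c_def)
  qed
  then show thesis using that rS by blast
qed

lemma weakly_tendsto_subseq:
  "weakly_tendsto x l \<Longrightarrow> strict_mono s \<Longrightarrow> weakly_tendsto (x \<circ> s) l"
  unfolding weakly_tendsto_def
  using LIMSEQ_subseq_LIMSEQ[of "\<lambda>k. x k \<bullet> u" for u] by (simp add: o_def)

lemma tendsto_imp_weakly_tendsto: "x \<longlonglongrightarrow> l \<Longrightarrow> weakly_tendsto x l"
  unfolding weakly_tendsto_def by (auto intro: tendsto_intros)

lemma weakly_tendsto_unique: "weakly_tendsto x l \<Longrightarrow> weakly_tendsto x l' \<Longrightarrow> l = l'"
  unfolding weakly_tendsto_def
  by (metis LIMSEQ_unique inner_commute vector_eq_rdot)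

lemma weakly_tendsto_inner: "weakly_tendsto x l \<Longrightarrow> (\<lambda>k. x k \<bullet> u) \<longlonglongrightarrow> l \<bullet> u"
  by (simp add: weakly_tendsto_def)

lemma bounded_imp_inner_products_subseq:
  fixes x :: "nat \<Rightarrow> 'a::real_inner"
  assumes "bounded (range x)"
  obtains s where "strict_mono (s :: nat \<Rightarrow> nat)" "\<And>j. convergent (\<lambda>k. x (s k) \<bullet> x j)"
proof -
  obtain M where M: "\<And>k. norm (x k) \<le> M" using assms by (auto simp: bounded_iff)
  interpret subseqs "\<lambda>j s. convergent (\<lambda>k. x (s k) \<bullet> x j)"
  proof
    fix j and s :: "nat \<Rightarrow> nat" assume "strict_mono s"
    have "norm (x (s k) \<bullet> x j) \<le> M * M" for k
      using Cauchy_Schwarz_ineq2[of "x (s k)" "x j"] mult_mono[OF M[of "s k"] M[of j]]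
        norm_ge_zero[of "x j"] order_trans[OF norm_ge_zero M]
      by (simp only: real_norm_def) (meson norm_ge_zero order_trans)
    then have "bounded (range (\<lambda>k. x (s k) \<bullet> x j))"
      by (auto simp: bounded_iff)
    then obtain l r where "strict_mono (r :: nat \<Rightarrow> nat)" "((\<lambda>k. x (s k) \<bullet> x j) \<circ> r) \<longlonglongrightarrow> l"
      using bounded_imp_convergent_subsequence by blast
    then show "\<exists>r'. strict_mono r' \<and> convergent (\<lambda>k. x ((s \<circ> r') k) \<bullet> x j)"
      by (auto simp: convergent_def o_def)
  qed
  have "convergent (\<lambda>k. x (diagseq k) \<bullet> x j)" for j
  proof -
    have "convergent (\<lambda>k. x ((diagseq \<circ> (+) (Suc j)) k) \<bullet> x j)"
      by (rule diagseq_holds)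
        (auto dest: convergent_subseq_convergent simp: o_def)
    then have "convergent (\<lambda>k. x (diagseq (k + Suc j)) \<bullet> x j)"
      by (simp add: o_def add.commute)
    then show ?thesis
      using convergent_ignore_initial_segment[where f = "\<lambda>k. x (diagseq k) \<bullet> x j"] by blast
  qed
  with subseq_diagseq show thesis using that by blast
qed

text \<open>
  A diagonal subsequence has convergent inner products with every member of \<open>x\<close>. The vectors with
  this property form a closed subspace \<open>S\<close> that contains the sequence, so the limit functional on \<open>S\<close>
  is represented by some \<open>r \<in> S\<close>, and an arbitrary test vector may be replaced by its projection
  onto \<open>S\<close>.
\<close>

theorem bounded_imp_weakly_convergent_subseq:
  fixes x :: "nat \<Rightarrow> 'a::{real_inner, complete_space}"
  assumes bdd: "bounded (range x)"
  shows "\<exists>s l. strict_mono (s :: nat \<Rightarrow> nat) \<and> weakly_tendsto (x \<circ> s) l"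
proof -
  obtain M where M0: "0 < M" and M: "\<And>k. norm (x k) \<le> M"
    using bdd by (auto simp: bounded_pos)
  obtain s where s: "strict_mono (s :: nat \<Rightarrow> nat)"
    and conv: "\<And>j. convergent (\<lambda>k. x (s k) \<bullet> x j)"
    using bounded_imp_inner_products_subseq[OF bdd] by blast
  define S where "S = {u. convergent (\<lambda>k. x (s k) \<bullet> u)}"
  define L where "L u = lim (\<lambda>k. x (s k) \<bullet> u)" for u
  have L: "(\<lambda>k. x (s k) \<bullet> u) \<longlonglongrightarrow> L u" if "u \<in> S" for u
    using that by (simp add: S_def L_def convergent_LIMSEQ_iff)
  have S1: "subspace S"
    unfolding subspace_def S_def
    by (auto simp: inner_add_right intro: convergent_add convergent_const convergent_mult)
  have inner_le: "\<bar>x k \<bullet> u\<bar> \<le> M * norm u" for k u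
    using Cauchy_Schwarz_ineq2[of "x k" u] mult_right_mono[OF M[of k] norm_ge_zero[of u]]
    by linarith
  have S2: "closed S"
    unfolding closed_sequential_limits
  proof (intro allI impI, elim conjE)
    fix v l assume v: "\<forall>n. v n \<in> S" and l: "v \<longlonglongrightarrow> l"
    have "Cauchy (\<lambda>k. x (s k) \<bullet> l)"
    proof (rule CauchyI)
      fix e :: real assume "0 < e"
      then have e3: "0 < e / (3 * M)" using M0 by simp
      then obtain n where n: "norm (v n - l) < e / (3 * M)"
        using LIMSEQ_D[OF l e3] by blast
      have small: "\<bar>x k \<bullet> (v n - l)\<bar> < e / 3" for k
      proof -
        have "\<bar>x k \<bullet> (v n - l)\<bar> \<le> M * norm (v n - l)" by (rule inner_le)
        also have "\<dots> < M * (e / (3 * M))"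
          using n M0 by (rule mult_strict_left_mono)
        also have "\<dots> = e / 3" using M0 by simp
        finally show ?thesis .
      qed
      have "Cauchy (\<lambda>k. x (s k) \<bullet> v n)"
        using v by (auto simp: S_def intro: convergent_Cauchy)
      moreover have "0 < e / 3" using \<open>0 < e\<close> by simp
      ultimately obtain N where
        N: "\<forall>i\<ge>N. \<forall>j\<ge>N. norm (x (s i) \<bullet> v n - x (s j) \<bullet> v n) < e / 3"
        using CauchyD by blast
      have "norm (x (s i) \<bullet> l - x (s j) \<bullet> l) < e" if "i \<ge> N" "j \<ge> N" for i j
        using small[of "s i"] small[of "s j"] N that
        by (simp add: inner_diff_right) (smt (verit, best) field_sum_of_halves)
      then show "\<exists>N. \<forall>i\<ge>N. \<forall>j\<ge>N. norm (x (s i) \<bullet> l - x (s j) \<bullet> l) < e" by blast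
    qed
    then show "l \<in> S" by (simp add: S_def real_Cauchy_convergent)
  qed
  have Ladd: "L (u + w) = L u + L w" if "u \<in> S" "w \<in> S" for u w
    using LIMSEQ_unique[OF L[OF subspace_add[OF S1 that]]] tendsto_add[OF L L, OF that]
    by (simp add: inner_add_right)
  have Lscale: "L (c *\<^sub>R u) = c * L u" if "u \<in> S" for c u
    using LIMSEQ_unique[OF L[OF subspace_scale[OF S1 that]]] tendsto_mult_left[OF L[OF that]]
    by simp
  have Lbound: "\<bar>L u\<bar> \<le> M * norm u" if "u \<in> S" for u
    using LIMSEQ_le_const2[OF tendsto_rabs[OF L[OF that]]] inner_le by blast
  obtain r where r: "r \<in> S" "\<And>w. w \<in> S \<Longrightarrow> L w = r \<bullet> w"
    using riesz_on_closed_subspace[OF S1 S2 Ladd Lscale Lbound] by blast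
  have "(\<lambda>k. x (s k) \<bullet> u) \<longlonglongrightarrow> r \<bullet> u" for u
  proof -
    \<comment> \<open>\<open>p\<close> is the orthogonal projection of \<open>u\<close> onto \<open>S\<close>.\<close>
    obtain p where p: "p \<in> S" "\<And>w. w \<in> S \<Longrightarrow> u \<bullet> w = p \<bullet> w"
      using riesz_on_closed_subspace[OF S1 S2, of "\<lambda>w. u \<bullet> w" "norm u"]
        Cauchy_Schwarz_ineq2[of u] inner_add_right inner_scaleR_right by blast
    have "x (s k) \<bullet> u = x (s k) \<bullet> p" for k
      using p(2)[of "x (s k)"] conv by (simp add: S_def inner_commute)
    moreover have "r \<bullet> u = L p" using p r by (metis inner_commute)
    ultimately show ?thesis using L[OF p(1)] by simp
  qed
  then have "weakly_tendsto (x \<circ> s) r" by (simp add: weakly_tendsto_def)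
  with s show ?thesis by blast
qed

lemma weakly_tendsto_if_subseqs:
  fixes x :: "nat \<Rightarrow> 'a::real_inner"
  assumes "\<And>s. strict_mono (s :: nat \<Rightarrow> nat) \<Longrightarrow>
      \<exists>r. strict_mono (r :: nat \<Rightarrow> nat) \<and> weakly_tendsto (x \<circ> s \<circ> r) l"
  shows "weakly_tendsto x l"
  unfolding weakly_tendsto_def
proof (intro allI, rule ccontr)
  fix u assume "\<not> (\<lambda>k. x k \<bullet> u) \<longlonglongrightarrow> l \<bullet> u"
  then obtain e where "e > 0" and e: "\<forall>N. \<exists>k\<ge>N. e \<le> \<bar>x k \<bullet> u - l \<bullet> u\<bar>"
    by (auto simp: LIMSEQ_iff not_less)
  then have "infinite {k. e \<le> \<bar>x k \<bullet> u - l \<bullet> u\<bar>}"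
    by (auto simp: infinite_nat_iff_unbounded_le)
  then obtain s :: "nat \<Rightarrow> nat" where s: "strict_mono s" "\<And>k. e \<le> \<bar>x (s k) \<bullet> u - l \<bullet> u\<bar>"
    using infinite_enumerate by blast
  then obtain r :: "nat \<Rightarrow> nat" where "weakly_tendsto (x \<circ> s \<circ> r) l"
    using assms by blast
  then have "(\<lambda>k. x (s (r k)) \<bullet> u) \<longlonglongrightarrow> l \<bullet> u"
    by (simp add: weakly_tendsto_def)
  then show False
    using LIMSEQ_D[of _ "l \<bullet> u" e] \<open>e > 0\<close> s(2) by (fastforce simp: not_less[symmetric])
qed

lemma weakly_tendsto_add:
  "weakly_tendsto x l \<Longrightarrow> weakly_tendsto y m \<Longrightarrow> weakly_tendsto (\<lambda>k. x k + y k) (l + m)"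
  unfolding weakly_tendsto_def inner_add_left by (auto intro!: tendsto_add)

lemma weakly_tendsto_scaleR:
  "weakly_tendsto x l \<Longrightarrow> weakly_tendsto (\<lambda>k. c *\<^sub>R x k) (c *\<^sub>R l)"
  unfolding weakly_tendsto_def inner_scaleR_left by (auto intro!: tendsto_mult_left)

lemma weakly_tendsto_diff:
  "weakly_tendsto x l \<Longrightarrow> weakly_tendsto y m \<Longrightarrow> weakly_tendsto (\<lambda>k. x k - y k) (l - m)"
  unfolding weakly_tendsto_def inner_diff_left by (auto intro!: tendsto_diff)

lemma weakly_tendsto_sum:
  "(\<And>i. i \<in> I \<Longrightarrow> weakly_tendsto (x i) (l i)) \<Longrightarrow>
    weakly_tendsto (\<lambda>k. \<Sum>i\<in>I. x i k) (\<Sum>i\<in>I. l i)"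
  unfolding weakly_tendsto_def inner_sum_left by (auto intro!: tendsto_sum)

lemma weakly_tendsto_vec_nth:
  assumes "weakly_tendsto x l"
  shows "weakly_tendsto (\<lambda>k. x k $ i) (l $ i)"
  unfolding weakly_tendsto_def
proof
  fix u
  show "(\<lambda>k. x k $ i \<bullet> u) \<longlonglongrightarrow> l $ i \<bullet> u"
    using weakly_tendsto_inner[OF assms, of "axis i u"] by (simp add: inner_axis)
qed

section \<open>Summable decreasing sequences\<close>

lemma tendsto_0_if_power2_norm:
  fixes v :: "nat \<Rightarrow> 'b::real_normed_vector"
  assumes "(\<lambda>k. (norm (v k))\<^sup>2) \<longlonglongrightarrow> 0"
  shows "v \<longlonglongrightarrow> 0"
  using tendsto_real_sqrt[OF assms] by (simp add: tendsto_norm_zero_iff)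

lemma summable_of_decrease:
  fixes a b :: "nat \<Rightarrow> real"
  assumes dec: "\<And>k. a (Suc k) + b k \<le> a k" and "\<And>k. 0 \<le> a k" "\<And>k. 0 \<le> b k"
  shows "summable b"
proof (rule summableI_nonneg_bounded)
  fix n
  have "sum b {..<n} \<le> a 0 - a n"
  proof (induction n)
    case (Suc n)
    then show ?case using dec[of n] by simp
  qed simp
  then show "sum b {..<n} \<le> a 0" using assms(2)[of n] by linarith
qed (rule assms(3))

text \<open>
  The terms with index between \<open>N\<close> and \<open>k\<close> are all at least \<open>f k\<close>, and their sum is small by the Cauchy
  criterion; for \<open>k \<ge> 2N\<close> they make up at least half of the indices below \<open>k\<close>.
\<close>

lemma decseq_summable_imp_smallo:
  fixes f :: "nat \<Rightarrow> real"
  assumes dec: "decseq f" and nonneg: "\<And>k. 0 \<le> f k" and sum: "summable f"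
  shows "(\<lambda>k. real k * f k) \<longlonglongrightarrow> 0"
proof (rule LIMSEQ_I)
  fix e :: real assume "0 < e"
  then have "0 < e / 2" by simp
  with sum obtain N where N: "\<And>m n. m \<ge> N \<Longrightarrow> norm (sum f {m..<n}) < e / 2"
    unfolding summable_Cauchy by blast
  have "norm (real k * f k - 0) < e" if k: "k \<ge> 2 * N" for k
  proof -
    have "real (k - N) * f k = (\<Sum>i\<in>{N..<k}. f k)" by simp
    also have "\<dots> \<le> sum f {N..<k}"
      using dec by (intro sum_mono) (auto simp: decseq_def)
    also have "\<dots> < e / 2" using N[of N k] by auto
    finally have "real (k - N) * f k < e / 2" .
    moreover have "real k \<le> 2 * real (k - N)" using k by (simp add: of_nat_diff)
    ultimately have "real k * f k < e"
      using mult_right_mono[OF _ nonneg[of k], of "real k" "2 * real (k - N)"] by simp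
    then show ?thesis using nonneg[of k] by simp
  qed
  then show "\<exists>N. \<forall>k\<ge>N. norm (real k * f k - 0) < e" by blast
qed

lemma norm_le_imp_smallo_inverse_sqrt:
  fixes f :: "nat \<Rightarrow> real" and v :: "nat \<Rightarrow> 'b::real_normed_vector"
  assumes lim: "(\<lambda>k. real k * f k) \<longlonglongrightarrow> 0"
    and le: "\<And>k. (norm (v k))\<^sup>2 \<le> C * f k"
  shows "(\<lambda>k. norm (v k)) \<in> o(\<lambda>k. 1 / sqrt (real k))"
proof (rule smalloI_tendsto)
  have "(\<lambda>k. sqrt (C * (real k * f k))) \<longlonglongrightarrow> 0"
    using tendsto_real_sqrt[OF tendsto_mult_left[OF lim, of C]] by simp
  then show "(\<lambda>k. norm (v k) / (1 / sqrt (real k))) \<longlonglongrightarrow> 0"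
  proof (rule Lim_null_comparison[rotated], intro always_eventually allI)
    fix k
    have "norm (norm (v k) / (1 / sqrt (real k))) = sqrt (real k * (norm (v k))\<^sup>2)"
      by (simp add: real_sqrt_mult)
    also have "\<dots> \<le> sqrt (real k * (C * f k))"
      using le[of k] by (intro real_sqrt_le_mono mult_left_mono) auto
    finally show "norm (norm (v k) / (1 / sqrt (real k))) \<le> sqrt (C * (real k * f k))"
      by (simp add: mult_ac)
  qed
  show "\<forall>\<^sub>F k in sequentially. 1 / sqrt (real k) \<noteq> 0"
    using eventually_gt_at_top[of 0] by eventually_elim simp
qed

section \<open>Resolvents and maximal monotone operators\<close>

lemma monotone_opD:
  assumes "monotone_op \<sigma> A" "u \<in> A x" "v \<in> A y"
  shows "\<sigma> * (norm (x - y))\<^sup>2 \<le> (x - y) \<bullet> (u - v)"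
  using assms by (auto simp: monotone_op_def gra_def)

lemma resolvent_lipschitz:
  assumes A: "monotone_op \<sigma> A" "u \<in> A x" "v \<in> A y" and "0 \<le> \<gamma>"
  shows "(1 + \<gamma> * \<sigma>) * norm (x - y) \<le> norm ((x + \<gamma> *\<^sub>R u) - (y + \<gamma> *\<^sub>R v))"
proof (cases "x = y")
  case False
  have "(1 + \<gamma> * \<sigma>) * (norm (x - y))\<^sup>2 \<le> (x - y) \<bullet> (x - y) + \<gamma> * ((x - y) \<bullet> (u - v))"
    using mult_left_mono[OF monotone_opD[OF A] \<open>0 \<le> \<gamma>\<close>]
    by (simp add: algebra_simps power2_norm_eq_inner)
  also have "\<dots> = (x - y) \<bullet> ((x + \<gamma> *\<^sub>R u) - (y + \<gamma> *\<^sub>R v))"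
    by (simp add: algebra_simps)
  also have "\<dots> \<le> norm (x - y) * norm ((x + \<gamma> *\<^sub>R u) - (y + \<gamma> *\<^sub>R v))"
    by (rule norm_cauchy_schwarz)
  finally have "norm (x - y) * ((1 + \<gamma> * \<sigma>) * norm (x - y))
      \<le> norm (x - y) * norm ((x + \<gamma> *\<^sub>R u) - (y + \<gamma> *\<^sub>R v))"
    by (simp add: power2_eq_square mult_ac)
  then show ?thesis using False by (simp add: mult_le_cancel_left)
qed simp

lemma resolvent_eq_singleton:
  assumes A: "monotone_op \<sigma> A" "u \<in> A x" and "0 \<le> \<gamma>" "0 < 1 + \<gamma> * \<sigma>"
  shows "resolvent \<gamma> A (x + \<gamma> *\<^sub>R u) = {x}"
proof -
  have "y = x" if "v \<in> A y" "x + \<gamma> *\<^sub>R u = y + \<gamma> *\<^sub>R v" for y v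
  proof -
    have "(1 + \<gamma> * \<sigma>) * norm (x - y) \<le> 0"
      using resolvent_lipschitz[OF A that(1) \<open>0 \<le> \<gamma>\<close>] that(2) by simp
    then show ?thesis using assms(4) by (simp add: mult_le_0_iff)
  qed
  then show ?thesis
    using assms(2) by (auto simp: resolvent_def op_inverse_def)
qed

lemma maximal_monotone_op_mem:
  assumes "maximal_monotone_op \<sigma> A"
    and related: "\<And>y v. v \<in> A y \<Longrightarrow> \<sigma> * (norm (x - y))\<^sup>2 \<le> (x - y) \<bullet> (u - v)"
  shows "u \<in> A x"
proof (rule ccontr)
  assume notin: "u \<notin> A x"
  define B where "B y = (if y = x then insert u (A y) else A y)" for y
  have gra_B: "gra B = insert (x, u) (gra A)" by (auto simp: gra_def B_def split: if_splits)
  have A: "monotone_op \<sigma> A" using assms(1) by (simp add: maximal_monotone_op_def)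
  have "\<sigma> * (norm (y - x))\<^sup>2 \<le> (y - x) \<bullet> (v - u)" if "v \<in> A y" for y v
    using related[OF that] by (simp add: norm_minus_commute inner_diff_left inner_diff_right algebra_simps)
  then have "monotone_op \<sigma> B"
    using A related unfolding monotone_op_def gra_B by (auto simp: gra_def)
  moreover have "gra A \<subset> gra B" using notin gra_B by (auto simp: gra_def)
  ultimately show False using assms(1) by (auto simp: maximal_monotone_op_def)
qed

text \<open>
  The single products \<open>\<langle>p\<^sub>j, a\<^sub>j\<rangle>\<close> need not converge under weak convergence; only convergence of their
  sum is required. The limit inequality holds for all simultaneous choices of graph elements
  \<open>(q\<^sub>j, c\<^sub>j)\<close>. By maximality every summand can be made nonpositive by a suitable choice, and
  negative if the limit pair with index \<open>j\<close> is not in the graph. As the choices are independent, this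
  contradicts the inequality for the sum.
\<close>

lemma product_demiclosed:
  fixes A :: "'j::finite \<Rightarrow> 'a::real_inner operator" and p a :: "nat \<Rightarrow> 'j \<Rightarrow> 'a"
  assumes maximal: "\<And>j. maximal_monotone_op (\<sigma> j) (A j)"
    and graph: "\<And>k j. a k j \<in> A j (p k j)"
    and p: "\<And>j. weakly_tendsto (\<lambda>k. p k j) (p' j)"
    and a: "\<And>j. weakly_tendsto (\<lambda>k. a k j) (a' j)"
    and pairing: "(\<lambda>k. \<Sum>j\<in>UNIV. p k j \<bullet> a k j) \<longlonglongrightarrow> (\<Sum>j\<in>UNIV. p' j \<bullet> a' j)"
    and norm: "\<And>j q. (\<lambda>k. \<sigma> j * (norm (p k j - q))\<^sup>2) \<longlonglongrightarrow> \<sigma> j * (norm (p' j - q))\<^sup>2"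
  shows "a' j \<in> A j (p' j)"
proof -
  define gap where "gap j q c = (p' j - q) \<bullet> (a' j - c) - \<sigma> j * (norm (p' j - q))\<^sup>2" for j q c
  have sum_gap: "0 \<le> (\<Sum>j\<in>UNIV. gap j (q j) (c j))" if "\<And>j. c j \<in> A j (q j)" for q c
  proof -
    define gapk where "gapk k = (\<Sum>j\<in>UNIV. p k j \<bullet> a k j) - (\<Sum>j\<in>UNIV. a k j \<bullet> q j)
        - (\<Sum>j\<in>UNIV. p k j \<bullet> c j) + (\<Sum>j\<in>UNIV. q j \<bullet> c j)
        - (\<Sum>j\<in>UNIV. \<sigma> j * (norm (p k j - q j))\<^sup>2)" for k
    have "gapk \<longlonglongrightarrow> (\<Sum>j\<in>UNIV. p' j \<bullet> a' j) - (\<Sum>j\<in>UNIV. a' j \<bullet> q j)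
        - (\<Sum>j\<in>UNIV. p' j \<bullet> c j) + (\<Sum>j\<in>UNIV. q j \<bullet> c j)
        - (\<Sum>j\<in>UNIV. \<sigma> j * (norm (p' j - q j))\<^sup>2)"
      unfolding gapk_def
      by (intro tendsto_add tendsto_diff tendsto_const tendsto_sum pairing norm
            weakly_tendsto_inner p a)
    then have lim: "gapk \<longlonglongrightarrow> (\<Sum>j\<in>UNIV. gap j (q j) (c j))"
      by (simp add: gap_def inner_diff_left inner_diff_right sum.distrib sum_subtractf inner_commute
          algebra_simps)
    have "0 \<le> gapk k" for k
    proof -
      have "gapk k = (\<Sum>j\<in>UNIV. (p k j - q j) \<bullet> (a k j - c j) - \<sigma> j * (norm (p k j - q j))\<^sup>2)"
        by (simp add: gapk_def inner_diff_left inner_diff_right sum.distrib sum_subtractf inner_commute)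
      also have "\<dots> \<ge> 0"
        using maximal graph that
        by (intro sum_nonneg) (auto simp: maximal_monotone_op_def intro!: monotone_opD)
      finally show ?thesis .
    qed
    with lim show ?thesis by (intro LIMSEQ_le_const) auto
  qed
  have "\<exists>q c. c \<in> A j q \<and> gap j q c \<le> 0 \<and> (a' j \<notin> A j (p' j) \<longrightarrow> gap j q c < 0)" for j
  proof (cases "a' j \<in> A j (p' j)")
    case True
    then show ?thesis by (intro exI[of _ "p' j"] exI[of _ "a' j"]) (simp add: gap_def)
  next
    case False
    then obtain q c where "c \<in> A j q" "(p' j - q) \<bullet> (a' j - c) < \<sigma> j * (norm (p' j - q))\<^sup>2"
      using maximal_monotone_op_mem[OF maximal[of j], of "p' j" "a' j"] not_le by blast
    then show ?thesis by (intro exI[of _ q] exI[of _ c]) (simp add: gap_def)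
  qed
  then obtain q c where c: "\<And>j. c j \<in> A j (q j)" and le: "\<And>j. gap j (q j) (c j) \<le> 0"
    and less: "\<And>j. a' j \<notin> A j (p' j) \<Longrightarrow> gap j (q j) (c j) < 0"
    by metis
  show ?thesis
  proof (rule ccontr)
    assume "a' j \<notin> A j (p' j)"
    then have "(\<Sum>j\<in>UNIV. gap j (q j) (c j)) < (\<Sum>j\<in>(UNIV :: 'j set). 0)"
      using le less by (intro sum_strict_mono_ex1) auto
    with sum_gap[OF c] show False by simp
  qed
qed

section \<open>The product space reformulation\<close>

lemma sum_UNIV_option:
  fixes f :: "'n::finite option \<Rightarrow> 'b::comm_monoid_add"
  shows "(\<Sum>j\<in>UNIV. f j) = f None + (\<Sum>i\<in>UNIV. f (Some i))"
  by (simp add: UNIV_option_conv sum.reindex)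

lemma zer_sum_iff:
  fixes A :: "'j::finite \<Rightarrow> 'a::comm_monoid_add operator"
  shows "q \<in> zer (\<lambda>p. \<Sum>j\<in>UNIV. A j p) \<longleftrightarrow> (\<exists>u. (\<forall>j. u j \<in> A j q) \<and> (\<Sum>j\<in>UNIV. u j) = 0)"
proof -
  have "(\<Sum>j\<in>UNIV. A j q) = {sum u UNIV |u. \<forall>j\<in>UNIV. u j \<in> A j q}"
    by (rule set_sum_alt) simp
  then show ?thesis by (auto simp: zer_def)
qed

lemma inv_weight_map:
  fixes \<omega> :: "'n::finite \<Rightarrow> real"
  assumes "\<And>i. \<omega> i > 0"
  shows "inv (weight_map \<omega> :: 'a::real_vector ^ 'n \<Rightarrow> 'a ^ 'n) = weight_map (\<lambda>i. 1 / \<omega> i)"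
  using assms
  by (intro inv_equality) (auto simp: weight_map_def vec_eq_iff less_imp_neq[symmetric])

lemma mem_J_F_iff:
  fixes A :: "'n::finite option \<Rightarrow> 'a::real_inner operator"
  assumes "\<And>i. \<omega> i > 0"
  shows "z \<in> J_F A \<omega> \<gamma> x \<longleftrightarrow>
    (\<exists>a. \<forall>i. a i \<in> A (Some i) (z $ i) \<and> x $ i = z $ i + (\<gamma> / \<omega> i) *\<^sub>R a i)"
proof -
  have "z \<in> J_F A \<omega> \<gamma> x \<longleftrightarrow> (\<exists>u\<in>F_op A z. x = z + \<gamma> *\<^sub>R weight_map (\<lambda>i. 1 / \<omega> i) u)"
    by (auto simp: J_F_def warped_resolvent_def resolvent_def op_inverse_def inv_weight_map[OF assms])
  also have "\<dots> \<longleftrightarrow>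
    (\<exists>u. (\<forall>i. u $ i \<in> A (Some i) (z $ i)) \<and> (\<forall>i. x $ i = z $ i + (\<gamma> / \<omega> i) *\<^sub>R u $ i))"
    by (simp add: F_op_def weight_map_def vec_eq_iff Bex_def)
  also have "\<dots> \<longleftrightarrow>
    (\<exists>a. \<forall>i. a i \<in> A (Some i) (z $ i) \<and> x $ i = z $ i + (\<gamma> / \<omega> i) *\<^sub>R a i)"
    by (metis vec_lambda_beta)
  finally show ?thesis .
qed

text \<open>
  Adding the coordinates of the inclusion with weights eliminates the normal vector, whose
  coordinates sum to zero; conversely the normal vector is determined by the other data.
\<close>

lemma mem_J_G_iff:
  fixes A :: "'n::finite option \<Rightarrow> 'a::real_inner operator"
  assumes \<omega>: "\<And>i. \<omega> i > 0" "(\<Sum>i\<in>UNIV. \<omega> i) = 1" and "0 < \<gamma>"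
  shows "y \<in> J_G A \<omega> \<gamma> w \<longleftrightarrow>
    (\<exists>p v. y = diag p \<and> v \<in> A None p \<and> p + \<gamma> *\<^sub>R v = (\<Sum>i\<in>UNIV. \<omega> i *\<^sub>R w $ i))"
proof
  assume "y \<in> J_G A \<omega> \<gamma> w"
  then obtain g where g: "g \<in> G_op A \<omega> y" and w: "w = y + \<gamma> *\<^sub>R weight_map (\<lambda>i. 1 / \<omega> i) g"
    by (auto simp: J_G_def warped_resolvent_def resolvent_def op_inverse_def inv_weight_map[OF \<omega>(1)])
  obtain k n where kn: "g = k + n" "k \<in> K_op A \<omega> y" "n \<in> normal_cone_diag y"
    using g by (auto simp: G_op_def elim: set_plus_elim)
  obtain p v where k: "k = (\<chi> i. \<omega> i *\<^sub>R v)" "y = diag p" "v \<in> A None p"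
    using kn(2) by (auto simp: K_op_def)
  have n: "(\<Sum>i\<in>UNIV. n $ i) = 0"
    using kn(3) by (auto simp: normal_cone_diag_def split: if_splits)
  have "\<omega> i *\<^sub>R w $ i = \<omega> i *\<^sub>R (p + \<gamma> *\<^sub>R v) + \<gamma> *\<^sub>R n $ i" for i
    using \<omega>(1)[of i] unfolding w kn(1) k(1,2)
    by (simp add: weight_map_def diag_def scaleR_add_right)
  then have "(\<Sum>i\<in>UNIV. \<omega> i *\<^sub>R w $ i)
      = (\<Sum>i\<in>UNIV. \<omega> i) *\<^sub>R (p + \<gamma> *\<^sub>R v) + \<gamma> *\<^sub>R (\<Sum>i\<in>UNIV. n $ i)"
    by (simp only: sum.distrib scaleR_left.sum scaleR_right.sum)
  then have "p + \<gamma> *\<^sub>R v = (\<Sum>i\<in>UNIV. \<omega> i *\<^sub>R w $ i)" by (simp only: n \<omega>(2)) simp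
  with k show "\<exists>p v. y = diag p \<and> v \<in> A None p \<and> p + \<gamma> *\<^sub>R v = (\<Sum>i\<in>UNIV. \<omega> i *\<^sub>R w $ i)"
    by blast
next
  assume "\<exists>p v. y = diag p \<and> v \<in> A None p \<and> p + \<gamma> *\<^sub>R v = (\<Sum>i\<in>UNIV. \<omega> i *\<^sub>R w $ i)"
  then obtain p v where y: "y = diag p" and v: "v \<in> A None p"
    and pv: "p + \<gamma> *\<^sub>R v = (\<Sum>i\<in>UNIV. \<omega> i *\<^sub>R w $ i)"
    by blast
  define n where "n = (\<chi> i. (\<omega> i / \<gamma>) *\<^sub>R (w $ i - (p + \<gamma> *\<^sub>R v)))"
  have "(\<Sum>i\<in>UNIV. n $ i) = (1 / \<gamma>) *\<^sub>R (\<Sum>i\<in>UNIV. \<omega> i *\<^sub>R w $ i - \<omega> i *\<^sub>R (p + \<gamma> *\<^sub>R v))"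
    by (simp add: n_def scaleR_right.sum scaleR_diff_right)
  also have "(\<Sum>i\<in>UNIV. \<omega> i *\<^sub>R w $ i - \<omega> i *\<^sub>R (p + \<gamma> *\<^sub>R v))
      = (\<Sum>i\<in>UNIV. \<omega> i *\<^sub>R w $ i) - (\<Sum>i\<in>UNIV. \<omega> i) *\<^sub>R (p + \<gamma> *\<^sub>R v)"
    by (simp only: sum_subtractf scaleR_left.sum)
  finally have "n \<in> normal_cone_diag y" by (simp add: normal_cone_diag_def y \<omega>(2) pv)
  moreover have "(\<chi> i. \<omega> i *\<^sub>R v) \<in> K_op A \<omega> y" using v y by (auto simp: K_op_def)
  ultimately have "(\<chi> i. \<omega> i *\<^sub>R v) + n \<in> G_op A \<omega> y"
    unfolding G_op_def by (rule set_plus_intro[rotated])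
  moreover have "w = y + \<gamma> *\<^sub>R weight_map (\<lambda>i. 1 / \<omega> i) ((\<chi> i. \<omega> i *\<^sub>R v) + n)"
    using \<omega>(1) \<open>0 < \<gamma>\<close>
    by (auto simp: vec_eq_iff y diag_def weight_map_def n_def scaleR_add_right less_imp_neq[symmetric])
  ultimately show "y \<in> J_G A \<omega> \<gamma> w"
    by (auto simp: J_G_def warped_resolvent_def resolvent_def op_inverse_def inv_weight_map[OF \<omega>(1)])
qed

text \<open>
  A certificate for \<open>z \<in> J\<^sub>F(x)\<close> and \<open>(p, \<dots>, p) \<in> J\<^sub>G(2z - x)\<close>: the family \<open>u\<close> records the elements
  of the operator values that realize both resolvents.
\<close>

definition splitting ::
    "('n::finite option \<Rightarrow> 'a::real_inner operator) \<Rightarrow> ('n \<Rightarrow> real) \<Rightarrow> real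
      \<Rightarrow> 'a ^ 'n \<Rightarrow> 'a ^ 'n \<Rightarrow> 'a \<Rightarrow> ('n option \<Rightarrow> 'a) \<Rightarrow> bool" where
  "splitting A \<omega> \<gamma> x z p u \<longleftrightarrow>
     (\<forall>i. u (Some i) \<in> A (Some i) (z $ i) \<and> x $ i = z $ i + (\<gamma> / \<omega> i) *\<^sub>R u (Some i)) \<and>
     u None \<in> A None p \<and> p + \<gamma> *\<^sub>R u None = (\<Sum>i\<in>UNIV. \<omega> i *\<^sub>R (2 *\<^sub>R z $ i - x $ i))"

lemma splitting_iff:
  fixes A :: "'n::finite option \<Rightarrow> 'a::real_inner operator"
  assumes \<omega>: "\<And>i. \<omega> i > 0" "(\<Sum>i\<in>UNIV. \<omega> i) = 1" and "0 < \<gamma>"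
  shows "z \<in> J_F A \<omega> \<gamma> x \<and> y \<in> J_G A \<omega> \<gamma> (2 *\<^sub>R z - x)
    \<longleftrightarrow> (\<exists>p u. y = diag p \<and> splitting A \<omega> \<gamma> x z p u)"
proof
  assume "z \<in> J_F A \<omega> \<gamma> x \<and> y \<in> J_G A \<omega> \<gamma> (2 *\<^sub>R z - x)"
  then obtain a p v where
    "\<forall>i. a i \<in> A (Some i) (z $ i) \<and> x $ i = z $ i + (\<gamma> / \<omega> i) *\<^sub>R a i" and
    "y = diag p" "v \<in> A None p" "p + \<gamma> *\<^sub>R v = (\<Sum>i\<in>UNIV. \<omega> i *\<^sub>R (2 *\<^sub>R z - x) $ i)"
    unfolding mem_J_F_iff[OF \<omega>(1)] mem_J_G_iff[OF assms] by blast
  then have "y = diag p \<and> splitting A \<omega> \<gamma> x z p (case_option v a)"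
    by (simp add: splitting_def)
  then show "\<exists>p u. y = diag p \<and> splitting A \<omega> \<gamma> x z p u" by blast
next
  assume "\<exists>p u. y = diag p \<and> splitting A \<omega> \<gamma> x z p u"
  then show "z \<in> J_F A \<omega> \<gamma> x \<and> y \<in> J_G A \<omega> \<gamma> (2 *\<^sub>R z - x)"
    unfolding mem_J_F_iff[OF \<omega>(1)] mem_J_G_iff[OF assms] splitting_def by force
qed

text \<open>
  When all \<open>z\<^sub>i\<close> equal \<open>p = q\<close>, the equation for the last resolvent says that the \<open>u\<^sub>j\<close> sum to zero.
\<close>

lemma zero_sum_iff_fixed_splitting:
  fixes A :: "'n::finite option \<Rightarrow> 'a::real_inner operator"
  assumes \<omega>: "\<And>i. \<omega> i > 0" "(\<Sum>i\<in>UNIV. \<omega> i) = 1" and "0 < \<gamma>"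
  shows "q \<in> zer (\<lambda>p. \<Sum>j\<in>UNIV. A j p) \<longleftrightarrow> (\<exists>x u. splitting A \<omega> \<gamma> x (diag q) q u)"
proof -
  have balance: "(q + \<gamma> *\<^sub>R u None = (\<Sum>i\<in>UNIV. \<omega> i *\<^sub>R (2 *\<^sub>R q - x $ i))) \<longleftrightarrow> (\<Sum>j\<in>UNIV. u j) = 0"
    if x: "\<And>i. x $ i = q + (\<gamma> / \<omega> i) *\<^sub>R u (Some i)" for x :: "'a ^ 'n" and u
  proof -
    have "\<omega> i *\<^sub>R (2 *\<^sub>R q - x $ i) = \<omega> i *\<^sub>R q - \<gamma> *\<^sub>R u (Some i)" for i
      using \<omega>(1)[of i] by (simp add: x scaleR_2 scaleR_diff_right scaleR_add_right)
    then have "(\<Sum>i\<in>UNIV. \<omega> i *\<^sub>R (2 *\<^sub>R q - x $ i)) = q - \<gamma> *\<^sub>R (\<Sum>i\<in>UNIV. u (Some i))"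
      by (simp add: sum_subtractf scaleR_right.sum \<omega>(2) flip: scaleR_left.sum)
    moreover have "(q + \<gamma> *\<^sub>R u None = q - \<gamma> *\<^sub>R (\<Sum>i\<in>UNIV. u (Some i)))
        \<longleftrightarrow> \<gamma> *\<^sub>R (\<Sum>j\<in>UNIV. u j) = 0"
      by (simp add: sum_UNIV_option scaleR_add_right eq_diff_eq add.commute add.left_commute)
    ultimately show ?thesis using \<open>0 < \<gamma>\<close> by simp
  qed
  show ?thesis
  proof
    assume "q \<in> zer (\<lambda>p. \<Sum>j\<in>UNIV. A j p)"
    then obtain u where u: "\<forall>j. u j \<in> A j q" "(\<Sum>j\<in>UNIV. u j) = 0"
      by (auto simp: zer_sum_iff)
    then have "splitting A \<omega> \<gamma> (\<chi> i. q + (\<gamma> / \<omega> i) *\<^sub>R u (Some i)) (diag q) q u"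
      using balance[of "\<chi> i. q + (\<gamma> / \<omega> i) *\<^sub>R u (Some i)" u]
      by (simp add: splitting_def diag_def)
    then show "\<exists>x u. splitting A \<omega> \<gamma> x (diag q) q u" by blast
  next
    assume "\<exists>x u. splitting A \<omega> \<gamma> x (diag q) q u"
    then obtain x u where s: "splitting A \<omega> \<gamma> x (diag q) q u" by blast
    have "u j \<in> A j q" for j
      using s by (cases j) (auto simp: splitting_def diag_def)
    moreover have "(\<Sum>j\<in>UNIV. u j) = 0"
      using s balance[of x u] by (simp add: splitting_def diag_def)
    ultimately show "q \<in> zer (\<lambda>p. \<Sum>j\<in>UNIV. A j p)"
      unfolding zer_sum_iff by blast
  qed
qed

section \<open>The weighted norm\<close>

lemma weight_map_add: "weight_map \<omega> (x + y) = weight_map \<omega> x + weight_map \<omega> y"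
  by (simp add: weight_map_def vec_eq_iff scaleR_add_right)

lemma weight_map_diff: "weight_map \<omega> (x - y) = weight_map \<omega> x - weight_map \<omega> y"
  by (simp add: weight_map_def vec_eq_iff scaleR_diff_right)

lemma weight_map_scaleR: "weight_map \<omega> (c *\<^sub>R x) = c *\<^sub>R weight_map \<omega> x"
  by (simp add: weight_map_def vec_eq_iff)

lemma weight_map_inner_commute: "weight_map \<omega> x \<bullet> y = weight_map \<omega> y \<bullet> x"
  by (simp add: weight_map_def inner_vec_def inner_commute)

text \<open>
  The square of the norm in which the Douglas-Rachford operator is averaged; the corresponding inner
  product is \<open>weight_map \<omega> x \<bullet> y\<close>.
\<close>

definition wsq :: "('n::finite \<Rightarrow> real) \<Rightarrow> 'a::real_inner ^ 'n \<Rightarrow> real" where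
  "wsq \<omega> x = weight_map \<omega> x \<bullet> x"

lemma wsq_eq_sum: "wsq \<omega> x = (\<Sum>i\<in>UNIV. \<omega> i * (norm (x $ i))\<^sup>2)"
  by (simp add: wsq_def weight_map_def inner_vec_def power2_norm_eq_inner)

lemma wsq_add_scaleR:
  "wsq \<omega> (x + c *\<^sub>R d) = wsq \<omega> x + 2 * c * (weight_map \<omega> x \<bullet> d) + c\<^sup>2 * wsq \<omega> d"
  using weight_map_inner_commute[of \<omega> d x]
  by (simp add: wsq_def weight_map_add weight_map_scaleR inner_add_left inner_add_right
      power2_eq_square algebra_simps)

lemma wsq_nonneg: "(\<And>i. \<omega> i > 0) \<Longrightarrow> 0 \<le> wsq \<omega> x"
  by (simp add: wsq_eq_sum sum_nonneg less_imp_le)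

lemma wsq_eq_0_iff: "(\<And>i. \<omega> i > 0) \<Longrightarrow> wsq \<omega> x = 0 \<longleftrightarrow> x = 0"
  by (simp add: wsq_eq_sum sum_nonneg_eq_0_iff less_imp_le less_imp_neq[symmetric] vec_eq_iff)

lemma power2_norm_vec: "(norm x)\<^sup>2 = (\<Sum>i\<in>UNIV. (norm (x $ i))\<^sup>2)"
  for x :: "'a::real_normed_vector ^ 'n::finite"
  by (simp add: norm_vec_def L2_set_def sum_nonneg)

lemma norm_le_wsq:
  fixes x :: "'a::real_inner ^ 'n::finite"
  assumes "\<And>i. \<omega> i > 0"
  shows "(norm x)\<^sup>2 \<le> 1 / Min (range \<omega>) * wsq \<omega> x"
proof -
  have m: "Min (range \<omega>) > 0" "\<And>i. Min (range \<omega>) \<le> \<omega> i" using assms by auto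
  have "Min (range \<omega>) * (norm x)\<^sup>2 \<le> wsq \<omega> x"
    unfolding wsq_eq_sum power2_norm_vec sum_distrib_left
    by (intro sum_mono mult_right_mono m) simp
  then show ?thesis using m(1) by (simp add: field_simps)
qed

section \<open>Admissible step sizes\<close>

text \<open>
  The weight on the left is the largest possible one; the difference of the two sides is
  \<open>\<parallel>av - bw\<parallel>\<^sup>2/(a + b)\<close>.
\<close>

lemma parallel_sum_le:
  fixes v w :: "'a::real_inner"
  assumes "a > 0" "b > 0"
  shows "a * b / (a + b) * (norm (v + w))\<^sup>2 \<le> a * (norm v)\<^sup>2 + b * (norm w)\<^sup>2"
proof -
  have "(a + b) * (a * (norm v)\<^sup>2 + b * (norm w)\<^sup>2) - a * b * (norm (v + w))\<^sup>2
      = (norm (a *\<^sub>R v - b *\<^sub>R w))\<^sup>2"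
    by (simp add: power2_norm_eq_inner inner_add_left inner_add_right inner_diff_left
        inner_diff_right inner_commute algebra_simps)
  then have "a * b * (norm (v + w))\<^sup>2 \<le> (a + b) * (a * (norm v)\<^sup>2 + b * (norm w)\<^sup>2)"
    using zero_le_power2[of "norm (a *\<^sub>R v - b *\<^sub>R w)"] by linarith
  then show ?thesis using assms by (simp add: pos_divide_le_eq mult.commute)
qed

text \<open>
  This trades the modulus \<open>\<sigma>\<close> at \<open>z\<close> and the share \<open>s\<close> at \<open>p\<close>, one of which may be negative, for a
  multiple of \<open>\<parallel>p - z\<parallel>\<^sup>2\<close> and a square.
\<close>

lemma shift_identity:
  fixes p z :: "'a::real_inner"
  assumes "\<sigma> + s \<noteq> 0"
  shows "s * (norm p)\<^sup>2 + \<sigma> * (norm z)\<^sup>2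
    = \<sigma> * s / (\<sigma> + s) * (norm (p - z))\<^sup>2 + (norm (\<sigma> *\<^sub>R z + s *\<^sub>R p))\<^sup>2 / (\<sigma> + s)"
proof -
  have "(\<sigma> + s) * (s * (norm p)\<^sup>2 + \<sigma> * (norm z)\<^sup>2)
      = \<sigma> * s * (norm (p - z))\<^sup>2 + (norm (\<sigma> *\<^sub>R z + s *\<^sub>R p))\<^sup>2"
    by (simp add: power2_norm_eq_inner inner_add_left inner_add_right inner_diff_left
        inner_diff_right inner_commute algebra_simps)
  then show ?thesis using assms
    by (simp add: add_divide_distrib[symmetric] eq_divide_eq mult.commute)
qed

lemma shift_le:
  fixes \<sigma> s :: real
  assumes "\<sigma> + s > 0"
  shows "\<sigma> * s / (\<sigma> + s) \<le> \<sigma>" "\<sigma> * s / (\<sigma> + s) \<le> s"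
  using assms by (simp_all add: pos_divide_le_eq algebra_simps)

text \<open>
  The numbers \<open>s\<^sub>i\<close> are the shares \<open>\<sigma>\<^sub>m\<delta>\<^sub>i\<close> of the modulus of the last operator. The last inequality is
  the constraint of the step size problem, multiplied by \<open>\<omega>\<^sub>i\<close>, at the actual step size and with
  strict inequality. In this form it also describes the monotone case, in which any nonnegative
  shares will do.
\<close>

definition admissible ::
    "('n::finite option \<Rightarrow> real) \<Rightarrow> ('n \<Rightarrow> real) \<Rightarrow> real \<Rightarrow> real \<Rightarrow> ('n \<Rightarrow> real) \<Rightarrow> bool" where
  "admissible \<sigma> \<omega> \<gamma> \<mu> s \<longleftrightarrow> (\<Sum>i\<in>UNIV. s i) = \<sigma> None \<and>
     (\<forall>i. (\<sigma> (Some i) = 0 \<and> 0 \<le> s i) \<or>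
       (\<sigma> (Some i) \<noteq> 0 \<and> 0 < \<sigma> (Some i) + s i \<and>
        0 < (1 - \<mu> / 2) * \<omega> i + \<gamma> * (\<sigma> (Some i) * s i / (\<sigma> (Some i) + s i))))"

lemma admissible_if_monotone:
  assumes "\<And>j. \<sigma> j \<ge> 0" "\<And>i. \<omega> i > 0" "(\<Sum>i\<in>UNIV. \<omega> i) = 1" "0 < \<gamma>" "\<mu> < 2"
  shows "admissible \<sigma> \<omega> \<gamma> \<mu> (\<lambda>i. \<omega> i * \<sigma> None)"
proof -
  have "0 < \<sigma> (Some i) + \<omega> i * \<sigma> None \<and>
      0 < (1 - \<mu> / 2) * \<omega> i + \<gamma> * (\<sigma> (Some i) * (\<omega> i * \<sigma> None) / (\<sigma> (Some i) + \<omega> i * \<sigma> None))"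
    if "\<sigma> (Some i) \<noteq> 0" for i
  proof -
    have "0 < \<sigma> (Some i)" using that assms(1)[of "Some i"] by simp
    moreover have "0 \<le> \<omega> i * \<sigma> None" using assms(1)[of None] assms(2)[of i] by simp
    ultimately show ?thesis
      using assms(2)[of i] assms(4,5) by (auto intro!: add_pos_nonneg mult_pos_pos)
  qed
  then show ?thesis
    using assms by (auto simp: admissible_def less_imp_le simp flip: sum_distrib_right)
qed

text \<open>
  The constraint is affine in the step size. It holds weakly at some \<open>b > \<gamma>\<close> and strictly at \<open>0\<close>
  because \<open>\<mu> < 2\<close>, hence strictly at \<open>\<gamma>\<close>.
\<close>

lemma admissible_if_nonmonotone:
  assumes "\<And>i. \<omega> i > 0" "0 < \<gamma>" "\<mu> < 2"
    and "nonmonotone_case \<sigma> \<omega> \<mu> bound" "ereal \<gamma> < bound"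
  shows "\<exists>s. admissible \<sigma> \<omega> \<gamma> \<mu> s"
proof -
  define I where "I = {i. \<sigma> (Some i) \<noteq> 0}"
  obtain b \<delta> where "\<gamma> < b" and feas: "feasible \<sigma> \<omega> \<mu> \<delta> b"
    using assms(4,5) by (auto simp: nonmonotone_case_def optimal_value_def less_Sup_iff)
  have sum: "(\<Sum>i\<in>I. \<delta> i) = 1"
    using feas by (simp add: feasible_def Let_def I_def)
  define s where "s i = (if i \<in> I then \<sigma> None * \<delta> i else 0)" for i
  have "(\<Sum>i\<in>UNIV. s i) = \<sigma> None"
    using sum by (simp add: s_def sum.If_cases flip: sum_distrib_left)
  moreover have "0 < \<sigma> (Some i) + s i \<and>
      0 < (1 - \<mu> / 2) * \<omega> i + \<gamma> * (\<sigma> (Some i) * s i / (\<sigma> (Some i) + s i))" if "i \<in> I" for i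
  proof -
    define c where "c = \<sigma> (Some i) * s i / (\<sigma> (Some i) + s i)"
    have pos: "0 < \<sigma> (Some i) + s i" and le: "0 \<le> 1 + b / \<omega> i * c - \<mu> / 2"
      using feas that \<open>\<gamma> < b\<close> \<open>0 < \<gamma>\<close>
      by (auto simp: feasible_def Let_def I_def s_def c_def order.order_iff_strict mult.assoc
          split: if_splits)
    have "0 \<le> \<omega> i * (1 + b / \<omega> i * c - \<mu> / 2)"
      using le assms(1)[of i] by simp
    then have "0 \<le> (1 - \<mu> / 2) * \<omega> i + b * c"
      using assms(1)[of i] by (simp add: algebra_simps)
    then have "0 \<le> \<gamma> * ((1 - \<mu> / 2) * \<omega> i + b * c)" using \<open>0 < \<gamma>\<close> by simp
    moreover have "0 < (b - \<gamma>) * ((1 - \<mu> / 2) * \<omega> i)"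
      using assms(1)[of i] assms(3) \<open>\<gamma> < b\<close> by simp
    \<comment> \<open>Interpolation between the step sizes \<open>0\<close> and \<open>b\<close>.\<close>
    moreover have "b * (w + \<gamma> * c) = (b - \<gamma>) * w + \<gamma> * (w + b * c)" for w
      by (simp add: algebra_simps)
    ultimately have "0 < b * ((1 - \<mu> / 2) * \<omega> i + \<gamma> * c)"
      by simp
    then show ?thesis using pos \<open>\<gamma> < b\<close> \<open>0 < \<gamma>\<close> by (simp add: c_def zero_less_mult_iff)
  qed
  ultimately have "admissible \<sigma> \<omega> \<gamma> \<mu> s"
    by (auto simp: admissible_def s_def I_def)
  then show ?thesis by blast
qed

text \<open>
  The number \<open>\<sigma>s/(\<sigma> + s)\<close> lies below both \<open>\<sigma>\<close> and \<open>s\<close>, so the constraint survives when it is replaced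
  by either of them. The first replacement gives the claim for the operators \<open>A\<^sub>i\<close>; the second one,
  summed over all coordinates, gives the claim for the last operator.
\<close>

lemma admissible_resolvable:
  assumes \<omega>: "\<And>i. \<omega> i > 0" "(\<Sum>i\<in>UNIV. \<omega> i) = 1" and "0 < \<gamma>" "0 < \<mu>" "\<mu> < 2"
    and s: "admissible \<sigma> \<omega> \<gamma> \<mu> s"
  shows "0 < 1 + \<gamma> / \<omega> i * \<sigma> (Some i)" "0 < 1 + \<gamma> * \<sigma> None"
proof -
  have both: "0 < (1 - \<mu> / 2) * \<omega> i + \<gamma> * \<sigma> (Some i) \<and> 0 < (1 - \<mu> / 2) * \<omega> i + \<gamma> * s i" for i
  proof (cases "\<sigma> (Some i) = 0")
    case True
    then have "0 \<le> s i" using s by (auto simp: admissible_def)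
    with True show ?thesis using \<omega>(1)[of i] assms(3,5) by (simp add: add_pos_nonneg)
  next
    case False
    define c where "c = \<sigma> (Some i) * s i / (\<sigma> (Some i) + s i)"
    have sum: "0 < \<sigma> (Some i) + s i" and pos: "0 < (1 - \<mu> / 2) * \<omega> i + \<gamma> * c"
      using s False by (auto simp: admissible_def c_def)
    have "c \<le> \<sigma> (Some i)" "c \<le> s i"
      unfolding c_def using sum by (rule shift_le)+
    then have "\<gamma> * c \<le> \<gamma> * \<sigma> (Some i)" "\<gamma> * c \<le> \<gamma> * s i"
      using \<open>0 < \<gamma>\<close> by simp_all
    with pos show ?thesis by linarith
  qed
  have "(1 - \<mu> / 2) * \<omega> i \<le> \<omega> i" using \<omega>(1)[of i] \<open>0 < \<mu>\<close> by (simp add: mult_left_le_one_le algebra_simps)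
  then have "0 < \<omega> i + \<gamma> * \<sigma> (Some i)" using both[of i] by linarith
  then show "0 < 1 + \<gamma> / \<omega> i * \<sigma> (Some i)"
    using \<omega>(1)[of i] by (simp add: field_simps)
  have "0 < (\<Sum>i\<in>UNIV. (1 - \<mu> / 2) * \<omega> i + \<gamma> * s i)"
    using both by (intro sum_pos) auto
  also have "\<dots> = (1 - \<mu> / 2) + \<gamma> * \<sigma> None"
    using s \<omega>(2) by (simp add: admissible_def sum.distrib flip: sum_distrib_left)
  finally show "0 < 1 + \<gamma> * \<sigma> None" using \<open>0 < \<mu>\<close> by linarith
qed

text \<open>
  For \<open>\<sigma> \<noteq> 0\<close>, half of the surplus \<open>\<eta>\<close> in front of \<open>\<parallel>p - z\<parallel>\<^sup>2\<close> is kept for \<open>\<kappa>\<close>. The other half controls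
  \<open>\<sigma>(p - z)\<close>, and together with the square of \<open>\<sigma>z + sp\<close> it controls their sum \<open>(\<sigma> + s)p\<close>; this
  yields \<open>\<tau>\<close>.
\<close>

lemma coercive_coordinate:
  assumes "\<omega> > 0" "0 < \<gamma>" "\<mu> < 2"
    and s: "(\<sigma> = 0 \<and> 0 \<le> s) \<or> (\<sigma> \<noteq> 0 \<and> 0 < \<sigma> + s \<and>
      0 < (1 - \<mu> / 2) * \<omega> + \<gamma> * (\<sigma> * s / (\<sigma> + s)))"
  shows "\<exists>\<kappa> \<tau>. 0 < \<kappa> \<and> 0 \<le> \<tau> \<and> (\<sigma> \<noteq> 0 \<or> s \<noteq> 0 \<longrightarrow> 0 < \<tau>) \<and>
    (\<forall>p z :: 'a::real_inner. \<kappa> * (\<omega> * (norm (p - z))\<^sup>2) + \<tau> * (norm p)\<^sup>2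
      \<le> \<gamma> * (s * (norm p)\<^sup>2 + \<sigma> * (norm z)\<^sup>2) + (1 - \<mu> / 2) * (\<omega> * (norm (p - z))\<^sup>2))"
proof (cases "\<sigma> = 0")
  case True
  with s assms show ?thesis
    by (intro exI[of _ "1 - \<mu> / 2"] exI[of _ "\<gamma> * s"]) auto
next
  case False
  define \<eta> where "\<eta> = (1 - \<mu> / 2) * \<omega> + \<gamma> * (\<sigma> * s / (\<sigma> + s))"
  have sum: "0 < \<sigma> + s" and \<eta>: "0 < \<eta>" using s False by (auto simp: \<eta>_def)
  define a where "a = \<eta> / 2 / \<sigma>\<^sup>2"
  define b where "b = \<gamma> / (\<sigma> + s)"
  define \<tau> where "\<tau> = a * b / (a + b) * (\<sigma> + s)\<^sup>2"
  have a: "0 < a" using \<eta> False by (simp add: a_def)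
  have b: "0 < b" using \<open>0 < \<gamma>\<close> sum by (simp add: b_def)
  have \<tau>: "0 < \<tau>" using a b sum by (simp add: \<tau>_def)
  have "\<eta> / 2 / \<omega> * (\<omega> * (norm (p - z))\<^sup>2) + \<tau> * (norm p)\<^sup>2
      \<le> \<gamma> * (s * (norm p)\<^sup>2 + \<sigma> * (norm z)\<^sup>2) + (1 - \<mu> / 2) * (\<omega> * (norm (p - z))\<^sup>2)"
    for p z :: 'a
  proof -
    define D where "D = (norm (p - z))\<^sup>2"
    define e where "e = \<sigma> *\<^sub>R z + s *\<^sub>R p"
    have "\<sigma> *\<^sub>R (p - z) + e = (\<sigma> + s) *\<^sub>R p" by (simp add: e_def algebra_simps)
    then have "\<tau> * (norm p)\<^sup>2 = a * b / (a + b) * (norm (\<sigma> *\<^sub>R (p - z) + e))\<^sup>2"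
      by (simp add: \<tau>_def power_mult_distrib)
    also have "\<dots> \<le> a * (norm (\<sigma> *\<^sub>R (p - z)))\<^sup>2 + b * (norm e)\<^sup>2"
      using a b by (rule parallel_sum_le)
    also have "a * (norm (\<sigma> *\<^sub>R (p - z)))\<^sup>2 = \<eta> / 2 * D"
      using False by (simp add: a_def D_def power_mult_distrib)
    finally have 1: "\<tau> * (norm p)\<^sup>2 \<le> \<eta> / 2 * D + b * (norm e)\<^sup>2" .
    have 2: "\<gamma> * (s * (norm p)\<^sup>2 + \<sigma> * (norm z)\<^sup>2) + (1 - \<mu> / 2) * (\<omega> * D) = \<eta> * D + b * (norm e)\<^sup>2"
      using shift_identity[of \<sigma> s p z] sum
      by (simp add: \<eta>_def b_def e_def D_def algebra_simps)
    have "\<eta> / 2 / \<omega> * (\<omega> * D) = \<eta> / 2 * D" using \<open>\<omega> > 0\<close> by simp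
    with 1 2 show ?thesis unfolding D_def[symmetric] by linarith
  qed
  with \<eta> \<tau> \<open>\<omega> > 0\<close> show ?thesis
    by (intro exI[of _ "\<eta> / 2 / \<omega>"] exI[of _ \<tau>]) auto
qed

lemma admissible_coercive:
  assumes \<omega>: "\<And>i. \<omega> i > 0" and "0 < \<gamma>" "\<mu> < 2"
    and s: "admissible \<sigma> \<omega> \<gamma> \<mu> s"
  shows "\<exists>\<kappa> \<tau>. 0 < \<kappa> \<and> 0 \<le> \<tau> \<and> (0 < \<tau> \<or> (\<forall>j. \<sigma> j = 0)) \<and>
    (\<forall>(p :: 'a::real_inner) (z :: 'a ^ 'n::finite). \<kappa> * wsq \<omega> (diag p - z) + \<tau> * (norm p)\<^sup>2
      \<le> \<gamma> * (\<sigma> None * (norm p)\<^sup>2 + (\<Sum>i\<in>UNIV. \<sigma> (Some i) * (norm (z $ i))\<^sup>2))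
        + (1 - \<mu> / 2) * wsq \<omega> (diag p - z))"
proof -
  have "\<forall>i. \<exists>\<kappa> \<tau>. 0 < \<kappa> \<and> 0 \<le> \<tau> \<and> (\<sigma> (Some i) \<noteq> 0 \<or> s i \<noteq> 0 \<longrightarrow> 0 < \<tau>) \<and>
    (\<forall>p z :: 'a. \<kappa> * (\<omega> i * (norm (p - z))\<^sup>2) + \<tau> * (norm p)\<^sup>2
      \<le> \<gamma> * (s i * (norm p)\<^sup>2 + \<sigma> (Some i) * (norm z)\<^sup>2) + (1 - \<mu> / 2) * (\<omega> i * (norm (p - z))\<^sup>2))"
    using s by (intro allI coercive_coordinate[OF \<omega> assms(2,3)]) (auto simp: admissible_def)
  then obtain k t where k: "\<And>i. 0 < k i" and t: "\<And>i. 0 \<le> t i"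
    and t_pos: "\<And>i. \<sigma> (Some i) \<noteq> 0 \<or> s i \<noteq> 0 \<Longrightarrow> 0 < t i"
    and coord: "\<And>i (p :: 'a) z. k i * (\<omega> i * (norm (p - z))\<^sup>2) + t i * (norm p)\<^sup>2
      \<le> \<gamma> * (s i * (norm p)\<^sup>2 + \<sigma> (Some i) * (norm z)\<^sup>2) + (1 - \<mu> / 2) * (\<omega> i * (norm (p - z))\<^sup>2)"
    by metis
  define \<kappa> where "\<kappa> = Min (range k)"
  define \<tau> where "\<tau> = (\<Sum>i\<in>UNIV. t i)"
  have \<kappa>: "0 < \<kappa>" "\<And>i. \<kappa> \<le> k i" using k by (auto simp: \<kappa>_def)
  have \<tau>: "0 \<le> \<tau>" using t by (simp add: \<tau>_def sum_nonneg)
  have "0 < \<tau>" if "\<sigma> j \<noteq> 0" for j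
  proof -
    have "\<exists>i. \<sigma> (Some i) \<noteq> 0 \<or> s i \<noteq> 0"
    proof (cases j)
      case None
      then have "(\<Sum>i\<in>UNIV. s i) \<noteq> 0" using that s by (simp add: admissible_def)
      then show ?thesis by (metis sum.neutral)
    qed (use that in auto)
    then obtain i where "0 < t i" using t_pos by blast
    also have "t i \<le> \<tau>" unfolding \<tau>_def using t by (intro member_le_sum) auto
    finally show ?thesis .
  qed
  moreover have "\<kappa> * wsq \<omega> (diag p - z) + \<tau> * (norm p)\<^sup>2
      \<le> \<gamma> * (\<sigma> None * (norm p)\<^sup>2 + (\<Sum>i\<in>UNIV. \<sigma> (Some i) * (norm (z $ i))\<^sup>2))
        + (1 - \<mu> / 2) * wsq \<omega> (diag p - z)" for p :: 'a and z :: "'a ^ 'n"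
  proof -
    define D where "D i = \<omega> i * (norm (p - z $ i))\<^sup>2" for i
    have D: "wsq \<omega> (diag p - z) = (\<Sum>i\<in>UNIV. D i)"
      by (simp add: wsq_eq_sum D_def diag_def)
    have "\<kappa> * D i \<le> k i * D i" for i
      using \<kappa>(2) \<omega>[of i] by (intro mult_right_mono) (auto simp: D_def less_imp_le)
    then have "\<kappa> * D i + t i * (norm p)\<^sup>2
        \<le> \<gamma> * (s i * (norm p)\<^sup>2 + \<sigma> (Some i) * (norm (z $ i))\<^sup>2) + (1 - \<mu> / 2) * D i" for i
      using coord[of i p "z $ i"] unfolding D_def[symmetric] by (meson add_right_mono order_trans)
    then have "(\<Sum>i\<in>UNIV. \<kappa> * D i + t i * (norm p)\<^sup>2)
        \<le> (\<Sum>i\<in>UNIV. \<gamma> * (s i * (norm p)\<^sup>2 + \<sigma> (Some i) * (norm (z $ i))\<^sup>2) + (1 - \<mu> / 2) * D i)"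
      by (rule sum_mono)
    moreover have "(\<Sum>i\<in>UNIV. \<kappa> * D i + t i * (norm p)\<^sup>2) = \<kappa> * sum D UNIV + \<tau> * (norm p)\<^sup>2"
      by (simp add: sum.distrib \<tau>_def flip: sum_distrib_left sum_distrib_right)
    moreover have "(\<Sum>i\<in>UNIV. \<gamma> * (s i * (norm p)\<^sup>2 + \<sigma> (Some i) * (norm (z $ i))\<^sup>2) + (1 - \<mu> / 2) * D i)
        = \<gamma> * (\<sigma> None * (norm p)\<^sup>2 + (\<Sum>i\<in>UNIV. \<sigma> (Some i) * (norm (z $ i))\<^sup>2)) + (1 - \<mu> / 2) * sum D UNIV"
    proof -
      have "\<sigma> None = (\<Sum>i\<in>UNIV. s i)" using s by (simp add: admissible_def)
      then show ?thesis
        by (simp only: sum.distrib sum_distrib_left[symmetric] sum_distrib_right[symmetric])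
    qed
    ultimately show ?thesis unfolding D by linarith
  qed
  ultimately show ?thesis using \<kappa>(1) \<tau> by (intro exI[of _ \<kappa>] exI[of _ \<tau>]) blast
qed

section \<open>The Douglas-Rachford operator\<close>

text \<open>
  Multiplying the two resolvent equations by \<open>p\<close> cancels the mixed products \<open>\<langle>p, u\<^sub>i\<rangle>\<close>. The equations are
  linear, so the identity applies to a single splitting as well as to the difference of two.
\<close>

lemma DR_identity:
  fixes x z :: "'a::real_inner ^ 'n::finite"
  assumes \<omega>: "\<And>i. \<omega> i > 0" "(\<Sum>i\<in>UNIV. \<omega> i) = 1"
    and x: "\<And>i. x $ i = z $ i + (\<gamma> / \<omega> i) *\<^sub>R u (Some i)"
    and p: "p + \<gamma> *\<^sub>R u None = (\<Sum>i\<in>UNIV. \<omega> i *\<^sub>R (2 *\<^sub>R z $ i - x $ i))"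
  shows "weight_map \<omega> x \<bullet> (diag p - z) + wsq \<omega> (diag p - z)
    = - \<gamma> * (p \<bullet> u None + (\<Sum>i\<in>UNIV. z $ i \<bullet> u (Some i)))"
proof -
  have eq: "\<omega> i * (x $ i \<bullet> (p - z $ i)) + \<omega> i * (norm (p - z $ i))\<^sup>2
      = \<omega> i * (p \<bullet> p) - p \<bullet> (\<omega> i *\<^sub>R (2 *\<^sub>R z $ i - x $ i)) - \<gamma> * (z $ i \<bullet> u (Some i))" for i
  proof -
    define e where "e = \<gamma> *\<^sub>R u (Some i)"
    have "\<omega> i *\<^sub>R x $ i = \<omega> i *\<^sub>R z $ i + e"
      using \<omega>(1)[of i] by (simp add: x e_def scaleR_add_right)
    then have e: "e = \<omega> i *\<^sub>R (x $ i - z $ i)" by (simp add: scaleR_diff_right)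
    have "\<gamma> * (z $ i \<bullet> u (Some i)) = z $ i \<bullet> e" by (simp add: e_def)
    then show ?thesis
      unfolding e by (simp add: power2_norm_eq_inner algebra_simps inner_commute)
  qed
  have "weight_map \<omega> x \<bullet> (diag p - z) + wsq \<omega> (diag p - z)
      = (\<Sum>i\<in>UNIV. \<omega> i * (x $ i \<bullet> (p - z $ i)) + \<omega> i * (norm (p - z $ i))\<^sup>2)"
    by (simp add: wsq_eq_sum weight_map_def inner_vec_def diag_def sum.distrib)
  also have "\<dots> = (\<Sum>i\<in>UNIV. \<omega> i) * (p \<bullet> p) - p \<bullet> (\<Sum>i\<in>UNIV. \<omega> i *\<^sub>R (2 *\<^sub>R z $ i - x $ i))
      - \<gamma> * (\<Sum>i\<in>UNIV. z $ i \<bullet> u (Some i))"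
    unfolding eq by (simp only: sum_subtractf sum_distrib_right sum_distrib_left inner_sum_right)
  also have "\<dots> = p \<bullet> p - p \<bullet> (p + \<gamma> *\<^sub>R u None) - \<gamma> * (\<Sum>i\<in>UNIV. z $ i \<bullet> u (Some i))"
    by (simp only: p \<omega>(2) mult_1)
  finally show ?thesis by (simp add: algebra_simps)
qed

text \<open>
  The constants \<open>\<kappa>\<close> and \<open>\<tau>\<close> summarize the effect of the moduli and the step size. The last assumption
  is the alternative between the strongly convergent case and the case of plain monotone operators;
  it is what makes the terms \<open>\<sigma>\<^sub>j\<parallel>\<cdot>\<parallel>\<^sup>2\<close> pass to weak limits.
\<close>

locale warped_DR =
  fixes A :: "'n::finite option \<Rightarrow> 'a::{real_inner, complete_space} operator"
    and \<sigma> :: "'n option \<Rightarrow> real" and \<omega> :: "'n \<Rightarrow> real" and \<gamma> \<mu> \<kappa> \<tau> :: real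
  assumes maximal: "\<And>j. maximal_monotone_op (\<sigma> j) (A j)"
    and \<omega>_pos: "\<And>i. \<omega> i > 0" and \<omega>_sum: "(\<Sum>i\<in>UNIV. \<omega> i) = 1"
    and \<gamma>_pos: "0 < \<gamma>" and \<mu>_pos: "0 < \<mu>"
    and resolvable_Some: "\<And>i. 0 < 1 + \<gamma> / \<omega> i * \<sigma> (Some i)"
    and resolvable_None: "0 < 1 + \<gamma> * \<sigma> None"
    and \<kappa>_pos: "0 < \<kappa>" and \<tau>_nonneg: "0 \<le> \<tau>"
    and coercive: "\<And>p z. \<kappa> * wsq \<omega> (diag p - z) + \<tau> * (norm (p :: 'a))\<^sup>2
      \<le> \<gamma> * (\<sigma> None * (norm p)\<^sup>2 + (\<Sum>i\<in>UNIV. \<sigma> (Some i) * (norm (z $ i))\<^sup>2))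
        + (1 - \<mu> / 2) * wsq \<omega> (diag p - z)"
    and strong_or_monotone: "0 < \<tau> \<or> (\<forall>j. \<sigma> j = 0)"
begin

lemma monotone: "monotone_op (\<sigma> j) (A j)"
  using maximal by (simp add: maximal_monotone_op_def)

lemma splitting_diff:
  assumes "splitting A \<omega> \<gamma> x z p u" "splitting A \<omega> \<gamma> x' z' p' u'"
  shows "(x - x') $ i = (z - z') $ i + (\<gamma> / \<omega> i) *\<^sub>R (u (Some i) - u' (Some i))"
    and "(p - p') + \<gamma> *\<^sub>R (u None - u' None) = (\<Sum>i\<in>UNIV. \<omega> i *\<^sub>R (2 *\<^sub>R (z - z') $ i - (x - x') $ i))"
proof -
  show "(x - x') $ i = (z - z') $ i + (\<gamma> / \<omega> i) *\<^sub>R (u (Some i) - u' (Some i))"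
    using assms by (simp add: splitting_def scaleR_diff_right)
  have "(p - p') + \<gamma> *\<^sub>R (u None - u' None) = (p + \<gamma> *\<^sub>R u None) - (p' + \<gamma> *\<^sub>R u' None)"
    by (simp add: scaleR_diff_right)
  also have "\<dots> = (\<Sum>i\<in>UNIV. \<omega> i *\<^sub>R (2 *\<^sub>R z $ i - x $ i) - \<omega> i *\<^sub>R (2 *\<^sub>R z' $ i - x' $ i))"
    using assms by (simp add: splitting_def sum_subtractf)
  also have "\<dots> = (\<Sum>i\<in>UNIV. \<omega> i *\<^sub>R (2 *\<^sub>R (z - z') $ i - (x - x') $ i))"
    by (intro sum.cong) (simp_all add: algebra_simps)
  finally show "(p - p') + \<gamma> *\<^sub>R (u None - u' None)
      = (\<Sum>i\<in>UNIV. \<omega> i *\<^sub>R (2 *\<^sub>R (z - z') $ i - (x - x') $ i))" .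
qed

text \<open>
  Expanding the square, \<open>DR_identity\<close> turns the cross term into \<open>-\<parallel>d\<parallel>\<^sup>2\<close> minus monotonicity products,
  and coercivity absorbs the latter together with the quadratic term.
\<close>

lemma averaged:
  assumes s: "splitting A \<omega> \<gamma> x z p u" and s': "splitting A \<omega> \<gamma> x' z' p' u'"
  shows "wsq \<omega> ((x + \<mu> *\<^sub>R (diag p - z)) - (x' + \<mu> *\<^sub>R (diag p' - z')))
      + 2 * \<mu> * \<kappa> * wsq \<omega> ((diag p - z) - (diag p' - z')) + 2 * \<mu> * \<tau> * (norm (p - p'))\<^sup>2
    \<le> wsq \<omega> (x - x')"
proof -
  define d where "d = diag (p - p') - (z - z')"
  have d: "(diag p - z) - (diag p' - z') = d" by (simp add: d_def diag_def vec_eq_iff)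
  have step: "(x + \<mu> *\<^sub>R (diag p - z)) - (x' + \<mu> *\<^sub>R (diag p' - z')) = (x - x') + \<mu> *\<^sub>R d"
    by (simp add: d[symmetric] algebra_simps)
  define m where "m = (p - p') \<bullet> (u None - u' None)
      + (\<Sum>i\<in>UNIV. (z - z') $ i \<bullet> (u (Some i) - u' (Some i)))"
  define s where "s = \<sigma> None * (norm (p - p'))\<^sup>2
      + (\<Sum>i\<in>UNIV. \<sigma> (Some i) * (norm ((z - z') $ i))\<^sup>2)"
  have "s \<le> m"
    unfolding s_def m_def using assms
    by (intro add_mono sum_mono) (auto simp: splitting_def intro!: monotone_opD[OF monotone])
  then have "\<gamma> * s \<le> \<gamma> * m" using \<gamma>_pos by simp
  moreover have "\<kappa> * wsq \<omega> d + \<tau> * (norm (p - p'))\<^sup>2 \<le> \<gamma> * s + (1 - \<mu> / 2) * wsq \<omega> d"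
    unfolding d_def s_def by (rule coercive)
  moreover have "weight_map \<omega> (x - x') \<bullet> d + wsq \<omega> d = - \<gamma> * m"
    unfolding d_def m_def
    by (rule DR_identity[where u = "\<lambda>j. u j - u' j", OF \<omega>_pos \<omega>_sum splitting_diff[OF assms]])
  ultimately have "\<kappa> * wsq \<omega> d + \<tau> * (norm (p - p'))\<^sup>2
      \<le> - (weight_map \<omega> (x - x') \<bullet> d) - \<mu> / 2 * wsq \<omega> d"
    by (simp add: left_diff_distrib)
  then have "2 * \<mu> * (\<kappa> * wsq \<omega> d + \<tau> * (norm (p - p'))\<^sup>2)
      \<le> 2 * \<mu> * (- (weight_map \<omega> (x - x') \<bullet> d) - \<mu> / 2 * wsq \<omega> d)"
    using \<mu>_pos by (intro mult_left_mono) auto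
  then show ?thesis
    unfolding step d wsq_add_scaleR by (simp add: algebra_simps power2_eq_square)
qed

text \<open>
  Upper bounds, in the unweighted norm, for the Lipschitz constants of \<open>z\<close> and \<open>p\<close> as functions of \<open>x\<close>.
\<close>

definition lip_z :: real where
  "lip_z = (\<Sum>i\<in>UNIV. 1 / (1 + \<gamma> / \<omega> i * \<sigma> (Some i)))"

definition lip_p :: real where
  "lip_p = (2 * lip_z + 1) / (1 + \<gamma> * \<sigma> None)"

lemma lip_z_nonneg: "0 \<le> lip_z"
  unfolding lip_z_def using resolvable_Some by (intro sum_nonneg) (simp add: less_imp_le)

lemma lip_p_nonneg: "0 \<le> lip_p"
  unfolding lip_p_def using lip_z_nonneg resolvable_None by simp

lemma z_lipschitz:
  assumes s: "splitting A \<omega> \<gamma> x z p u" and s': "splitting A \<omega> \<gamma> x' z' p' u'"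
  shows "norm (z - z') \<le> lip_z * norm (x - x')"
proof -
  have comp: "norm ((z - z') $ i) \<le> 1 / (1 + \<gamma> / \<omega> i * \<sigma> (Some i)) * norm (x - x')" for i
  proof -
    have "(1 + \<gamma> / \<omega> i * \<sigma> (Some i)) * norm (z $ i - z' $ i) \<le> norm (x $ i - x' $ i)"
      using resolvent_lipschitz[OF monotone, of "u (Some i)" "Some i" "z $ i" "u' (Some i)" "z' $ i"
          "\<gamma> / \<omega> i"] s s' \<gamma>_pos \<omega>_pos[of i] by (simp add: splitting_def)
    also have "\<dots> \<le> norm (x - x')"
      using Finite_Cartesian_Product.norm_nth_le[of "x - x'" i] by simp
    finally show ?thesis
      using resolvable_Some[of i] by (simp add: pos_le_divide_eq mult.commute)
  qed
  have "norm (z - z') \<le> (\<Sum>i\<in>UNIV. norm ((z - z') $ i))"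
    unfolding norm_vec_def by (rule L2_set_le_sum) simp
  also have "\<dots> \<le> lip_z * norm (x - x')"
    unfolding lip_z_def sum_distrib_right by (rule sum_mono) (rule comp)
  finally show ?thesis .
qed

lemma p_lipschitz:
  assumes s: "splitting A \<omega> \<gamma> x z p u" and s': "splitting A \<omega> \<gamma> x' z' p' u'"
  shows "norm (p - p') \<le> lip_p * norm (x - x')"
proof -
  have "(1 + \<gamma> * \<sigma> None) * norm (p - p') \<le> norm ((p + \<gamma> *\<^sub>R u None) - (p' + \<gamma> *\<^sub>R u' None))"
    using s s' \<gamma>_pos by (intro resolvent_lipschitz[OF monotone]) (auto simp: splitting_def)
  also have "(p + \<gamma> *\<^sub>R u None) - (p' + \<gamma> *\<^sub>R u' None)
      = (\<Sum>i\<in>UNIV. \<omega> i *\<^sub>R (2 *\<^sub>R (z - z') $ i - (x - x') $ i))"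
    using splitting_diff(2)[OF s s'] by (simp add: scaleR_diff_right algebra_simps)
  also have "norm \<dots> \<le> (\<Sum>i\<in>UNIV. \<omega> i * ((2 * lip_z + 1) * norm (x - x')))"
  proof (rule sum_norm_le)
    fix i
    have "norm (2 *\<^sub>R (z - z') $ i - (x - x') $ i) \<le> 2 * norm ((z - z') $ i) + norm ((x - x') $ i)"
      using norm_triangle_ineq4[of "2 *\<^sub>R (z - z') $ i" "(x - x') $ i"] by simp
    also have "\<dots> \<le> (2 * lip_z + 1) * norm (x - x')"
      using z_lipschitz[OF s s'] Finite_Cartesian_Product.norm_nth_le[of "z - z'" i]
        Finite_Cartesian_Product.norm_nth_le[of "x - x'" i]
      unfolding distrib_right mult_1 mult.assoc by linarith
    finally show "norm (\<omega> i *\<^sub>R (2 *\<^sub>R (z - z') $ i - (x - x') $ i))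
        \<le> \<omega> i * ((2 * lip_z + 1) * norm (x - x'))"
      using \<omega>_pos[of i] by (simp only: norm_scaleR) simp
  qed
  also have "\<dots> = (2 * lip_z + 1) * norm (x - x')"
    by (simp only: sum_distrib_right[symmetric] \<omega>_sum mult_1)
  finally show ?thesis
    using resolvable_None by (simp add: lip_p_def pos_le_divide_eq mult.commute)
qed

lemma splitting_unique:
  assumes "splitting A \<omega> \<gamma> x z p u" "splitting A \<omega> \<gamma> x z' p' u'"
  shows "z = z'" "p = p'"
  using z_lipschitz[OF assms] p_lipschitz[OF assms] by simp_all

definition fixed_at :: "'a ^ 'n \<Rightarrow> 'a \<Rightarrow> bool" where
  "fixed_at x q \<longleftrightarrow> (\<exists>u. splitting A \<omega> \<gamma> x (diag q) q u)"

text \<open>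
  Two fixed points do not come closer in one step, so the decrease \<open>2\<mu>\<tau>\<parallel>q - q'\<parallel>\<^sup>2\<close> must vanish.
\<close>

lemma fixed_at_unique_if_strong:
  assumes "0 < \<tau>" "fixed_at x q" "fixed_at x' q'"
  shows "q = q'"
proof -
  obtain u u' where "splitting A \<omega> \<gamma> x (diag q) q u" "splitting A \<omega> \<gamma> x' (diag q') q' u'"
    using assms(2,3) by (auto simp: fixed_at_def)
  from averaged[OF this] have "2 * \<mu> * \<tau> * (norm (q - q'))\<^sup>2 \<le> 0"
    using wsq_eq_0_iff[of \<omega> "0 :: 'a ^ 'n"] \<omega>_pos by simp
  then show ?thesis using \<mu>_pos \<open>0 < \<tau>\<close> by (simp add: mult_le_0_iff)
qed

lemma U_op_at:
  assumes "splitting A \<omega> \<gamma> x (diag q) q u"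
  shows "U_op A \<omega> \<gamma> x = {q}"
proof -
  have "resolvent (\<gamma> / \<omega> i) (A (Some i)) (x $ i) = {q}" for i
    using assms resolvent_eq_singleton[OF monotone, of "u (Some i)" "Some i" q "\<gamma> / \<omega> i"]
      \<gamma>_pos \<omega>_pos[of i] resolvable_Some[of i] by (simp add: splitting_def diag_def)
  then have "(*\<^sub>R) (\<omega> i) ` reflected_resolvent (\<gamma> / \<omega> i) (A (Some i)) (x $ i)
      = {\<omega> i *\<^sub>R (2 *\<^sub>R q - x $ i)}" for i
    by (auto simp: reflected_resolvent_def)
  moreover have "(\<Sum>i\<in>UNIV. {\<omega> i *\<^sub>R (2 *\<^sub>R q - x $ i)}) = {\<Sum>i\<in>UNIV. \<omega> i *\<^sub>R (2 *\<^sub>R q - x $ i)}"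
    by (subst set_sum_alt) (auto intro!: exI sum.cong)
  moreover have "resolvent \<gamma> (A None) (\<Sum>i\<in>UNIV. \<omega> i *\<^sub>R (2 *\<^sub>R q - x $ i)) = {q}"
    using assms resolvent_eq_singleton[OF monotone, of "u None" None q \<gamma>]
      \<gamma>_pos resolvable_None by (simp add: splitting_def diag_def)
  ultimately show ?thesis by (simp add: U_op_def)
qed

text \<open>
  Uniqueness is argued coordinatewise rather than by comparing splittings, since a competing
  element of \<open>J\<^sub>F(x)\<close> does not come with a point \<open>p\<close>.
\<close>

lemma J_F_at:
  assumes "splitting A \<omega> \<gamma> x z p u"
  shows "J_F A \<omega> \<gamma> x = {z}"
proof -
  have "z' = z" if "z' \<in> J_F A \<omega> \<gamma> x" for z'
  proof -
    obtain a where a: "\<And>i. a i \<in> A (Some i) (z' $ i)" "\<And>i. x $ i = z' $ i + (\<gamma> / \<omega> i) *\<^sub>R a i"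
      using \<open>z' \<in> J_F A \<omega> \<gamma> x\<close> unfolding mem_J_F_iff[OF \<omega>_pos] by blast
    have "{z' $ i} = {z $ i}" for i
    proof -
      have "0 \<le> \<gamma> / \<omega> i" using \<gamma>_pos \<omega>_pos[of i] by simp
      then have "resolvent (\<gamma> / \<omega> i) (A (Some i)) (z' $ i + (\<gamma> / \<omega> i) *\<^sub>R a i) = {z' $ i}"
        by (rule resolvent_eq_singleton[OF monotone a(1) _ resolvable_Some])
      moreover have "u (Some i) \<in> A (Some i) (z $ i)" using assms by (simp add: splitting_def)
      then have "resolvent (\<gamma> / \<omega> i) (A (Some i)) (z $ i + (\<gamma> / \<omega> i) *\<^sub>R u (Some i)) = {z $ i}"
        using \<open>0 \<le> \<gamma> / \<omega> i\<close> resolvable_Some by (rule resolvent_eq_singleton[OF monotone])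
      moreover have "z' $ i + (\<gamma> / \<omega> i) *\<^sub>R a i = z $ i + (\<gamma> / \<omega> i) *\<^sub>R u (Some i)"
        using a(2)[of i] assms by (simp add: splitting_def)
      ultimately show ?thesis by simp
    qed
    then show ?thesis by (simp add: vec_eq_iff)
  qed
  moreover have "z \<in> J_F A \<omega> \<gamma> x"
    using assms splitting_iff[OF \<omega>_pos \<omega>_sum \<gamma>_pos] by blast
  ultimately show ?thesis by blast
qed

lemma DR_op_at:
  assumes "splitting A \<omega> \<gamma> x z p u"
  shows "DR_op A \<omega> \<gamma> \<mu> x = {x + \<mu> *\<^sub>R (diag p - z)}"
proof -
  have "(z' \<in> J_F A \<omega> \<gamma> x \<and> y' \<in> J_G A \<omega> \<gamma> (2 *\<^sub>R z' - x)) \<longleftrightarrow> z' = z \<and> y' = diag p" for y' z'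
    unfolding splitting_iff[OF \<omega>_pos \<omega>_sum \<gamma>_pos] using assms splitting_unique[OF assms] by blast
  then show ?thesis by (auto simp: DR_op_def)
qed

end

section \<open>The Douglas-Rachford iteration\<close>

locale warped_DR_iteration = warped_DR A \<sigma> \<omega> \<gamma> \<mu> \<kappa> \<tau>
  for A :: "'n::finite option \<Rightarrow> 'a::{real_inner, complete_space} operator"
    and \<sigma> :: "'n option \<Rightarrow> real" and \<omega> :: "'n \<Rightarrow> real" and \<gamma> \<mu> \<kappa> \<tau> :: real +
  fixes x z :: "nat \<Rightarrow> 'a ^ 'n" and p :: "nat \<Rightarrow> 'a" and u :: "nat \<Rightarrow> 'n option \<Rightarrow> 'a"
  assumes split: "\<And>k. splitting A \<omega> \<gamma> (x k) (z k) (p k) (u k)"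
    and step: "\<And>k. x (Suc k) = x k + \<mu> *\<^sub>R (diag (p k) - z k)"
    and fixed_exists: "\<exists>x q. fixed_at x q"
begin

definition d :: "nat \<Rightarrow> 'a ^ 'n" where "d k = diag (p k) - z k"

lemma fejer:
  assumes "fixed_at c q"
  shows "wsq \<omega> (x (Suc k) - c) + (2 * \<mu> * \<kappa> * wsq \<omega> (d k) + 2 * \<mu> * \<tau> * (norm (p k - q))\<^sup>2)
    \<le> wsq \<omega> (x k - c)"
proof -
  obtain w where w: "splitting A \<omega> \<gamma> c (diag q) q w" using assms by (auto simp: fixed_at_def)
  show ?thesis using averaged[OF split[of k] w] by (simp add: step d_def)
qed

lemma summable_drop:
  assumes "fixed_at c q"
  shows "summable (\<lambda>k. 2 * \<mu> * \<kappa> * wsq \<omega> (d k) + 2 * \<mu> * \<tau> * (norm (p k - q))\<^sup>2)"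
  using fejer[OF assms] \<mu>_pos \<kappa>_pos \<tau>_nonneg
  by (intro summable_of_decrease[of "\<lambda>k. wsq \<omega> (x k - c)"]) (auto simp: wsq_nonneg \<omega>_pos)

lemma wsq_fixed_antimono:
  assumes "fixed_at c q"
  shows "decseq (\<lambda>k. wsq \<omega> (x k - c))"
proof (rule decseq_SucI)
  fix k
  have "0 \<le> 2 * \<mu> * \<kappa> * wsq \<omega> (d k) + 2 * \<mu> * \<tau> * (norm (p k - q))\<^sup>2"
    using \<mu>_pos \<kappa>_pos \<tau>_nonneg by (simp add: wsq_nonneg \<omega>_pos)
  with fejer[OF assms, of k] show "wsq \<omega> (x (Suc k) - c) \<le> wsq \<omega> (x k - c)" by linarith
qed

lemma wsq_fixed_convergent:
  assumes "fixed_at c q"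
  shows "convergent (\<lambda>k. wsq \<omega> (x k - c))"
proof -
  have "\<forall>k. 0 \<le> wsq \<omega> (x k - c)" by (simp add: wsq_nonneg \<omega>_pos)
  then show ?thesis
    using decseq_convergent[OF wsq_fixed_antimono[OF assms]] by (metis convergent_def)
qed

lemma summable_d: "summable (\<lambda>k. wsq \<omega> (d k))"
proof -
  obtain c q where "fixed_at c q" using fixed_exists by blast
  then have "summable (\<lambda>k. 2 * \<mu> * \<kappa> * wsq \<omega> (d k))"
    using \<mu>_pos \<kappa>_pos \<tau>_nonneg
    by (intro summable_comparison_test'[OF summable_drop, of _ _ 0]) (auto simp: wsq_nonneg \<omega>_pos)
  then show ?thesis using \<mu>_pos \<kappa>_pos by (simp add: summable_cmult_iff)
qed

text \<open>
  Consecutive iterates differ by \<open>\<mu> d\<^sup>k\<close>, so this is nonexpansiveness applied to consecutive steps.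
\<close>

lemma d_antimono: "decseq (\<lambda>k. wsq \<omega> (d k))"
proof (rule decseq_SucI)
  fix k
  have "0 \<le> 2 * \<mu> * \<kappa> * wsq \<omega> (d (Suc k) - d k) + 2 * \<mu> * \<tau> * (norm (p (Suc k) - p k))\<^sup>2"
    using \<mu>_pos \<kappa>_pos \<tau>_nonneg by (simp add: wsq_nonneg \<omega>_pos)
  moreover have "x (Suc k) - x k = \<mu> *\<^sub>R d k" for k by (simp add: step d_def)
  moreover have "wsq \<omega> (x (Suc (Suc k)) - x (Suc k))
      + 2 * \<mu> * \<kappa> * wsq \<omega> (d (Suc k) - d k) + 2 * \<mu> * \<tau> * (norm (p (Suc k) - p k))\<^sup>2
    \<le> wsq \<omega> (x (Suc k) - x k)"
    unfolding d_def step[of "Suc k"] by (subst (2) step) (rule averaged[OF split split])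
  ultimately have "wsq \<omega> (\<mu> *\<^sub>R d (Suc k)) \<le> wsq \<omega> (\<mu> *\<^sub>R d k)"
    by simp
  moreover have "wsq \<omega> (\<mu> *\<^sub>R v) = \<mu>\<^sup>2 * wsq \<omega> v" for v :: "'a ^ 'n"
    by (simp add: wsq_def weight_map_scaleR power2_eq_square)
  ultimately show "wsq \<omega> (d (Suc k)) \<le> wsq \<omega> (d k)" using \<mu>_pos by simp
qed

lemma rate: "(\<lambda>k. real k * wsq \<omega> (d k)) \<longlonglongrightarrow> 0"
  using d_antimono wsq_nonneg[OF \<omega>_pos] summable_d by (rule decseq_summable_imp_smallo)

lemma residual_rate: "(\<lambda>k. norm (x k - x (Suc k))) \<in> o(\<lambda>k. 1 / sqrt (real k))"
  and z_rate: "(\<lambda>k. norm (z (Suc k) - z k)) \<in> o(\<lambda>k. 1 / sqrt (real k))"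
  and p_rate: "(\<lambda>k. norm (diag (p (Suc k)) - diag (p k) :: 'a ^ 'n)) \<in> o(\<lambda>k. 1 / sqrt (real k))"
proof -
  define c where "c = 1 / Min (range \<omega>)"
  have c: "(norm v)\<^sup>2 \<le> c * wsq \<omega> v" for v :: "'a ^ 'n"
    unfolding c_def using \<omega>_pos by (rule norm_le_wsq)
  have from_step: "(\<lambda>k. norm (v k)) \<in> o(\<lambda>k. 1 / sqrt (real k))"
    if "K \<ge> 0" "\<And>k. norm (v k) \<le> K * norm (x (Suc k) - x k)" for v :: "nat \<Rightarrow> 'a ^ 'n" and K
  proof (rule norm_le_imp_smallo_inverse_sqrt[OF rate, where C = "K\<^sup>2 * \<mu>\<^sup>2 * c"])
    fix k
    have "(norm (v k))\<^sup>2 \<le> (K * norm (x (Suc k) - x k))\<^sup>2"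
      using that(2) by (intro power_mono) auto
    also have "\<dots> = K\<^sup>2 * \<mu>\<^sup>2 * (norm (d k))\<^sup>2"
      by (simp add: step d_def power_mult_distrib)
    also have "\<dots> \<le> K\<^sup>2 * \<mu>\<^sup>2 * (c * wsq \<omega> (d k))"
      by (intro mult_left_mono c) simp
    finally show "(norm (v k))\<^sup>2 \<le> K\<^sup>2 * \<mu>\<^sup>2 * c * wsq \<omega> (d k)" by (simp add: mult.assoc)
  qed
  show "(\<lambda>k. norm (x k - x (Suc k))) \<in> o(\<lambda>k. 1 / sqrt (real k))"
    by (rule from_step[of 1]) (simp_all add: norm_minus_commute)
  show "(\<lambda>k. norm (z (Suc k) - z k)) \<in> o(\<lambda>k. 1 / sqrt (real k))"
    by (rule from_step[OF lip_z_nonneg z_lipschitz[OF split split]])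
  have "norm (diag a :: 'a ^ 'n) \<le> real CARD('n) * norm a" for a :: 'a
    unfolding norm_vec_def using L2_set_le_sum[of UNIV "\<lambda>i. norm (diag a $ i)"]
    by (simp add: diag_def)
  then have "norm (diag (p (Suc k)) - diag (p k) :: 'a ^ 'n) \<le> real CARD('n) * norm (p (Suc k) - p k)" for k
    by (metis (no_types) diag_def vec_eq_iff vec_lambda_beta vector_minus_component)
  moreover have "real CARD('n) * norm (p (Suc k) - p k) \<le> real CARD('n) * (lip_p * norm (x (Suc k) - x k))" for k
    using p_lipschitz[OF split split] by (intro mult_left_mono) auto
  ultimately have "norm (diag (p (Suc k)) - diag (p k) :: 'a ^ 'n)
      \<le> (real CARD('n) * lip_p) * norm (x (Suc k) - x k)" for k
    by (simp only: mult.assoc) (rule order_trans)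
  then show "(\<lambda>k. norm (diag (p (Suc k)) - diag (p k) :: 'a ^ 'n)) \<in> o(\<lambda>k. 1 / sqrt (real k))"
    using lip_p_nonneg by (intro from_step[of "real CARD('n) * lip_p"]) auto
qed

lemma d_tendsto_0: "d \<longlonglongrightarrow> 0"
proof -
  define c where "c = 1 / Min (range \<omega>)"
  have c: "(norm v)\<^sup>2 \<le> c * wsq \<omega> v" for v :: "'a ^ 'n"
    unfolding c_def using \<omega>_pos by (rule norm_le_wsq)
  have "(\<lambda>k. c * wsq \<omega> (d k)) \<longlonglongrightarrow> 0"
    using tendsto_mult_right_zero[OF summable_LIMSEQ_zero[OF summable_d]] .
  then have "(\<lambda>k. (norm (d k))\<^sup>2) \<longlonglongrightarrow> 0"
    by (rule Lim_null_comparison[rotated]) (simp add: c)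
  then show ?thesis by (rule tendsto_0_if_power2_norm)
qed

lemma p_diff_z_tendsto_0: "(\<lambda>k. p k - z k $ i) \<longlonglongrightarrow> 0"
  using tendsto_vec_nth[OF d_tendsto_0, of i] by (simp add: d_def diag_def)

lemma bounded_x: "bounded (range x)"
proof -
  obtain c q where cq: "fixed_at c q" using fixed_exists by blast
  define K where "K = 1 / Min (range \<omega>)"
  have K: "K > 0" "(norm v)\<^sup>2 \<le> K * wsq \<omega> v" for v :: "'a ^ 'n"
    unfolding K_def using \<omega>_pos by (simp_all add: norm_le_wsq del: times_divide_eq_left)
  have "norm (x k - c) \<le> sqrt (K * wsq \<omega> (x 0 - c))" for k
  proof (rule real_le_rsqrt)
    have "wsq \<omega> (x k - c) \<le> wsq \<omega> (x 0 - c)"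
      using wsq_fixed_antimono[OF cq] by (simp add: decseq_def)
    with K(1) have "K * wsq \<omega> (x k - c) \<le> K * wsq \<omega> (x 0 - c)" by simp
    with K(2) show "(norm (x k - c))\<^sup>2 \<le> K * wsq \<omega> (x 0 - c)" by (rule order_trans)
  qed
  then have "norm (x k) \<le> sqrt (K * wsq \<omega> (x 0 - c)) + norm c" for k
    using norm_triangle_sub[of "x k" c] by (smt (verit))
  then show ?thesis by (auto simp: bounded_iff)
qed

lemma bounded_z: "bounded (range z)"
proof -
  obtain M where M: "\<And>k. norm (x k) \<le> M" using bounded_x by (auto simp: bounded_iff)
  have "norm (z k) \<le> lip_z * (M + M) + norm (z 0)" for k
  proof -
    have "norm (z k - z 0) \<le> lip_z * norm (x k - x 0)" by (rule z_lipschitz[OF split split])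
    also have "\<dots> \<le> lip_z * (M + M)"
      using norm_triangle_ineq4[of "x k" "x 0"] M[of k] M[of 0] lip_z_nonneg
      by (intro mult_left_mono) auto
    finally show ?thesis using norm_triangle_sub[of "z k" "z 0"] by linarith
  qed
  then show ?thesis by (auto simp: bounded_iff)
qed

text \<open>
  \<open>DR_identity\<close> for the splitting of \<open>x\<^sup>k\<close> itself: the sum of the duality products is bounded by
  \<open>\<parallel>d\<^sup>k\<parallel>\<close> times a bounded factor.
\<close>

lemma pairing_tendsto_0: "(\<lambda>k. \<Sum>j\<in>UNIV. (case j of None \<Rightarrow> p k | Some i \<Rightarrow> z k $ i) \<bullet> u k j) \<longlonglongrightarrow> 0"
proof -
  obtain M where M: "\<And>k. norm (x k) \<le> M" using bounded_x by (auto simp: bounded_iff)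
  have \<omega>_le: "\<omega> i \<le> 1" for i
    using member_le_sum[of i UNIV \<omega>] \<omega>_sum \<omega>_pos by (simp add: less_imp_le)
  have W: "norm (weight_map \<omega> (x k)) \<le> M" for k
  proof -
    have "norm (weight_map \<omega> (x k)) \<le> norm (x k)"
      using \<omega>_le \<omega>_pos
      by (intro norm_le_componentwise_cart)
        (simp add: weight_map_def abs_of_pos mult_left_le_one_le less_imp_le)
    then show ?thesis using M[of k] by linarith
  qed
  have ineq: "norm (weight_map \<omega> (x k) \<bullet> d k) \<le> M * norm (d k)" for k
    using order_trans[OF Cauchy_Schwarz_ineq2 mult_right_mono[OF W norm_ge_zero]] by simp
  have "(\<lambda>k. M * norm (d k)) \<longlonglongrightarrow> 0"
    using d_tendsto_0 by (intro tendsto_mult_right_zero tendsto_norm_zero)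
  then have "(\<lambda>k. weight_map \<omega> (x k) \<bullet> d k) \<longlonglongrightarrow> 0"
    by (rule Lim_null_comparison[OF always_eventually[OF allI[OF ineq]]])
  then have "(\<lambda>k. (- 1 / \<gamma>) * (weight_map \<omega> (x k) \<bullet> d k + wsq \<omega> (d k))) \<longlonglongrightarrow> (- 1 / \<gamma>) * (0 + 0)"
    using summable_LIMSEQ_zero[OF summable_d] by (intro tendsto_intros)
  moreover have "(- 1 / \<gamma>) * (weight_map \<omega> (x k) \<bullet> d k + wsq \<omega> (d k))
      = (\<Sum>j\<in>UNIV. (case j of None \<Rightarrow> p k | Some i \<Rightarrow> z k $ i) \<bullet> u k j)" for k
  proof -
    have "weight_map \<omega> (x k) \<bullet> d k + wsq \<omega> (d k)
        = - \<gamma> * (p k \<bullet> u k None + (\<Sum>i\<in>UNIV. z k $ i \<bullet> u k (Some i)))"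
      unfolding d_def using split[of k]
      by (intro DR_identity[OF \<omega>_pos \<omega>_sum]) (auto simp: splitting_def)
    then show ?thesis using \<gamma>_pos by (simp add: sum_UNIV_option)
  qed
  ultimately show ?thesis by simp
qed

lemma p_tendsto_if_strong:
  assumes "0 < \<tau>" "fixed_at c q"
  shows "p \<longlonglongrightarrow> q"
proof -
  have "summable (\<lambda>k. 2 * \<mu> * \<tau> * (norm (p k - q))\<^sup>2)"
    using \<mu>_pos \<kappa>_pos \<tau>_nonneg
    by (intro summable_comparison_test'[OF summable_drop[OF assms(2)], of 0]) (auto simp: wsq_nonneg \<omega>_pos)
  then have "summable (\<lambda>k. (norm (p k - q))\<^sup>2)" using \<mu>_pos assms(1) by (simp add: summable_cmult_iff)
  then have "(\<lambda>k. (norm (p k - q))\<^sup>2) \<longlonglongrightarrow> 0" by (rule summable_LIMSEQ_zero)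
  then show ?thesis by (rule LIM_zero_cancel[OF tendsto_0_if_power2_norm])
qed

text \<open>
  The splitting equations express \<open>u\<close> linearly through \<open>x\<close>, \<open>z\<close> and \<open>p\<close>, so \<open>u\<close> converges weakly along
  the subsequence, to limits \<open>b\<close> that sum to zero. Thus the sum of the limiting duality products
  vanishes like the limit in \<open>pairing_tendsto_0\<close>, and demiclosedness applies.
\<close>

lemma weak_cluster_fixed:
  assumes s: "strict_mono (s :: nat \<Rightarrow> nat)" and xs: "weakly_tendsto (x \<circ> s) x'" and zs: "weakly_tendsto (z \<circ> s) z'"
  shows "\<exists>q. z' = diag q \<and> fixed_at x' q"
proof -
  obtain i0 :: 'n where True by blast
  define q where "q = z' $ i0"
  have zi: "weakly_tendsto (\<lambda>k. z (s k) $ i) (z' $ i)" for i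
    using weakly_tendsto_vec_nth[OF zs] by (simp add: o_def)
  have xi: "weakly_tendsto (\<lambda>k. x (s k) $ i) (x' $ i)" for i
    using weakly_tendsto_vec_nth[OF xs] by (simp add: o_def)
  have gap: "(\<lambda>k. p (s k) - z (s k) $ i) \<longlonglongrightarrow> 0" for i
    using LIMSEQ_subseq_LIMSEQ[OF p_diff_z_tendsto_0 s] by (simp add: o_def)
  have p: "weakly_tendsto (\<lambda>k. p (s k)) (z' $ i)" for i
    using weakly_tendsto_add[OF zi[of i] tendsto_imp_weakly_tendsto[OF gap[of i]]] by simp
  have z'i: "z' $ i = q" for i
    unfolding q_def using p by (rule weakly_tendsto_unique) (rule p)
  then have z': "z' = diag q" by (simp add: diag_def vec_eq_iff)
  define P where "P k j = (case j of None \<Rightarrow> p (s k) | Some i \<Rightarrow> z (s k) $ i)" for k j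
  define b where "b j = (case j of None \<Rightarrow> (1 / \<gamma>) *\<^sub>R ((\<Sum>i\<in>UNIV. \<omega> i *\<^sub>R (2 *\<^sub>R q - x' $ i)) - q)
    | Some i \<Rightarrow> (\<omega> i / \<gamma>) *\<^sub>R (x' $ i - q))" for j
  have u_Some: "u k (Some i) = (\<omega> i / \<gamma>) *\<^sub>R (x k $ i - z k $ i)" for k i
    using split[of k] \<gamma>_pos \<omega>_pos[of i] by (auto simp: splitting_def less_imp_neq[symmetric])
  have u_None: "u k None = (1 / \<gamma>) *\<^sub>R ((\<Sum>i\<in>UNIV. \<omega> i *\<^sub>R (2 *\<^sub>R z k $ i - x k $ i)) - p k)" for k
  proof -
    have "(\<Sum>i\<in>UNIV. \<omega> i *\<^sub>R (2 *\<^sub>R z k $ i - x k $ i)) - p k = \<gamma> *\<^sub>R u k None"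
      using split[of k] unfolding splitting_def by (metis add_diff_cancel_left')
    then show ?thesis using \<gamma>_pos by simp
  qed
  have bA: "b j \<in> A j q" for j
  proof (rule product_demiclosed[OF maximal, where p = P and a = "\<lambda>k. u (s k)" and p' = "\<lambda>j. q" and a' = b])
    show "u (s k) j \<in> A j (P k j)" for k j
      using split[of "s k"] by (cases j) (auto simp: splitting_def P_def)
    show "weakly_tendsto (\<lambda>k. P k j) q" for j
      using zi p z'i by (cases j) (auto simp: P_def)
    show "weakly_tendsto (\<lambda>k. u (s k) j) (b j)" for j
      using zi p z'i by (cases j)
        (auto simp: u_Some u_None b_def intro!: weakly_tendsto_scaleR weakly_tendsto_diff
          weakly_tendsto_sum xi)
    have "(\<Sum>j\<in>UNIV. b j) = 0"
    proof -
      have "\<gamma> *\<^sub>R (\<Sum>j\<in>UNIV. b j)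
          = (\<Sum>i\<in>UNIV. \<omega> i *\<^sub>R (2 *\<^sub>R q - x' $ i)) - q + (\<Sum>i\<in>UNIV. \<omega> i *\<^sub>R (x' $ i - q))"
        using \<gamma>_pos by (simp add: sum_UNIV_option b_def scaleR_add_right scaleR_right.sum)
      also have "\<dots> = (\<Sum>i\<in>UNIV. \<omega> i *\<^sub>R (2 *\<^sub>R q - x' $ i) + \<omega> i *\<^sub>R (x' $ i - q)) - q"
        by (simp only: sum.distrib) simp
      also have "\<dots> = (\<Sum>i\<in>UNIV. \<omega> i *\<^sub>R q) - q"
        by (intro arg_cong2[of _ _ _ _ "(-)"] sum.cong) (simp_all add: scaleR_2 algebra_simps)
      also have "\<dots> = 0" by (simp add: \<omega>_sum flip: scaleR_left.sum)
      finally show ?thesis using \<gamma>_pos by simp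
    qed
    then have "(\<Sum>j\<in>UNIV. q \<bullet> b j) = 0" by (simp flip: inner_sum_right)
    then show "(\<lambda>k. \<Sum>j\<in>UNIV. P k j \<bullet> u (s k) j) \<longlonglongrightarrow> (\<Sum>j\<in>UNIV. q \<bullet> b j)"
      using LIMSEQ_subseq_LIMSEQ[OF pairing_tendsto_0 s] by (simp add: o_def P_def)
    \<comment> \<open>Either the convergence is strong, or the moduli are zero.\<close>
    show "(\<lambda>k. \<sigma> j * (norm (P k j - r))\<^sup>2) \<longlonglongrightarrow> \<sigma> j * (norm (q - r))\<^sup>2" for j r
      using strong_or_monotone
    proof
      assume "0 < \<tau>"
      obtain c q' where "fixed_at c q'" using fixed_exists by blast
      with \<open>0 < \<tau>\<close> have "p \<longlonglongrightarrow> q'" by (rule p_tendsto_if_strong)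
      then have ps: "(\<lambda>k. p (s k)) \<longlonglongrightarrow> q'" using LIMSEQ_subseq_LIMSEQ[OF _ s] by (auto simp: o_def)
      then have "q = q'"
        using weakly_tendsto_unique[OF p[of i0] tendsto_imp_weakly_tendsto] z'i by auto
      with ps have ps: "(\<lambda>k. p (s k)) \<longlonglongrightarrow> q" by simp
      have "(\<lambda>k. z (s k) $ i) \<longlonglongrightarrow> q" for i
        using tendsto_diff[OF ps gap[of i]] by simp
      with ps have "(\<lambda>k. P k j) \<longlonglongrightarrow> q" by (cases j) (auto simp: P_def)
      then show ?thesis by (intro tendsto_intros)
    qed simp
  qed
  then have "splitting A \<omega> \<gamma> x' (diag q) q b"
    using \<gamma>_pos \<omega>_pos
    by (auto simp: splitting_def diag_def bA) (auto simp: b_def less_imp_neq[symmetric])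
  with z' show ?thesis by (auto simp: fixed_at_def)
qed

text \<open>
  Opial's argument: the difference of the squared distances to \<open>c\<close> and \<open>c'\<close> converges and is affine
  in \<open>x\<^sup>k\<close>. Hence the weighted product of \<open>x\<^sup>k\<close> with \<open>c' - c\<close> converges, and its limits along the two
  subsequences agree.
\<close>

lemma weak_cluster_unique:
  assumes "fixed_at c q" "fixed_at c' q'"
    and s: "strict_mono (s :: nat \<Rightarrow> nat)" "weakly_tendsto (x \<circ> s) c"
    and r: "strict_mono (r :: nat \<Rightarrow> nat)" "weakly_tendsto (x \<circ> r) c'"
  shows "c = c'"
proof -
  have "wsq \<omega> (x k - c) - wsq \<omega> (x k - c') + (wsq \<omega> c' - wsq \<omega> c) = 2 * (x k \<bullet> weight_map \<omega> (c' - c))" for k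
    using weight_map_inner_commute[of \<omega> "x k" c] weight_map_inner_commute[of \<omega> "x k" c']
    by (simp add: wsq_def weight_map_diff inner_diff_left inner_diff_right inner_commute)
  moreover have "convergent (\<lambda>k. wsq \<omega> (x k - c) - wsq \<omega> (x k - c') + (wsq \<omega> c' - wsq \<omega> c))"
    using assms(1,2) by (intro convergent_add convergent_diff convergent_const wsq_fixed_convergent)
  ultimately have "convergent (\<lambda>k. x k \<bullet> weight_map \<omega> (c' - c))"
    by (simp add: convergent_mult_const_iff)
  then obtain l where l: "(\<lambda>k. x k \<bullet> weight_map \<omega> (c' - c)) \<longlonglongrightarrow> l" by (auto simp: convergent_def)
  have "c \<bullet> weight_map \<omega> (c' - c) = l"
    using LIMSEQ_unique[OF weakly_tendsto_inner[OF s(2), unfolded o_def] LIMSEQ_subseq_LIMSEQ[OF l s(1), unfolded o_def]]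
    by (simp add: o_def)
  moreover have "c' \<bullet> weight_map \<omega> (c' - c) = l"
    using LIMSEQ_unique[OF weakly_tendsto_inner[OF r(2), unfolded o_def] LIMSEQ_subseq_LIMSEQ[OF l r(1), unfolded o_def]]
    by (simp add: o_def)
  ultimately have "wsq \<omega> (c' - c) = 0" by (simp add: wsq_def inner_commute[of "weight_map _ _"] inner_diff_left)
  then show ?thesis by (simp add: wsq_eq_0_iff \<omega>_pos)
qed

lemma subseq_cluster:
  assumes s: "strict_mono (s :: nat \<Rightarrow> nat)"
  shows "\<exists>r c q. strict_mono (r :: nat \<Rightarrow> nat) \<and> weakly_tendsto (x \<circ> s \<circ> r) c
    \<and> weakly_tendsto (z \<circ> s \<circ> r) (diag q) \<and> fixed_at c q"
proof -
  have "bounded (range (x \<circ> s))" using bounded_x by (rule bounded_subset) auto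
  from bounded_imp_weakly_convergent_subseq[OF this]
  obtain r1 c where r1: "strict_mono r1" "weakly_tendsto (x \<circ> s \<circ> r1) c" by blast
  have "bounded (range (z \<circ> s \<circ> r1))" using bounded_z by (rule bounded_subset) auto
  from bounded_imp_weakly_convergent_subseq[OF this]
  obtain r2 z' where r2: "strict_mono r2" "weakly_tendsto (z \<circ> s \<circ> r1 \<circ> r2) z'" by blast
  define r where "r = r1 \<circ> r2"
  have r: "strict_mono r" unfolding r_def using r1(1) r2(1) by (rule strict_mono_o)
  have x: "weakly_tendsto (x \<circ> s \<circ> r) c"
    using weakly_tendsto_subseq[OF r1(2) r2(1)] by (simp add: r_def o_assoc)
  have z: "weakly_tendsto (z \<circ> s \<circ> r) z'" using r2(2) by (simp add: r_def o_assoc)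
  obtain q where q: "z' = diag q" "fixed_at c q"
    using weak_cluster_fixed[OF strict_mono_o[OF s r], of c z'] x z by (auto simp: o_assoc)
  show ?thesis using r x z q by blast
qed

text \<open>
  Every subsequence has a further subsequence along which \<open>x\<close> and \<open>z\<close> converge weakly to a fixed
  point and its splitting. The fixed point is always the same, and it determines the limit of \<open>z\<close>.
\<close>

theorem weak_convergence:
  shows "\<exists>xbar q. fixed_at xbar q \<and> weakly_tendsto x xbar \<and> weakly_tendsto z (diag q)"
proof -
  have "strict_mono (id :: nat \<Rightarrow> nat)" by (simp add: strict_mono_def)
  from subseq_cluster[OF this]
  obtain r c q where r: "strict_mono r" "weakly_tendsto (x \<circ> id \<circ> r) c"
    and fixed: "fixed_at c q"
    by blast
  have sub: "\<exists>r. strict_mono (r :: nat \<Rightarrow> nat) \<and> weakly_tendsto (x \<circ> s \<circ> r) c \<and> weakly_tendsto (z \<circ> s \<circ> r) (diag q)"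
    if s: "strict_mono s" for s :: "nat \<Rightarrow> nat"
  proof -
    obtain r' c' q' where r': "strict_mono r'" "weakly_tendsto (x \<circ> s \<circ> r') c'"
      and z: "weakly_tendsto (z \<circ> s \<circ> r') (diag q')" and fixed': "fixed_at c' q'"
      using subseq_cluster[OF s] by blast
    have "c = c'"
      using weak_cluster_unique[OF fixed fixed' r(1) _ strict_mono_o[OF s r'(1)]] r(2) r'(2)
      by (simp add: o_assoc)
    with fixed fixed' have "q = q'" using splitting_unique(2) by (auto simp: fixed_at_def)
    with \<open>c = c'\<close> r' z show ?thesis by auto
  qed
  have "weakly_tendsto x c"
    by (rule weakly_tendsto_if_subseqs) (metis sub)
  moreover have "weakly_tendsto z (diag q)"
    by (rule weakly_tendsto_if_subseqs) (metis sub)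
  ultimately show ?thesis using fixed by blast
qed

end

section \<open>The convergence theorem\<close>

theorem theorem4p14:
  fixes A :: "'n::finite option \<Rightarrow> 'a::{real_inner, complete_space} \<Rightarrow> 'a set"
    and \<sigma> :: "'n option \<Rightarrow> real"
    and \<omega> :: "'n \<Rightarrow> real"
    and \<mu> \<gamma> :: real
    and bound :: ereal
    and x y z :: "nat \<Rightarrow> 'a ^ 'n"
  assumes "\<And>i. maximal_monotone_op (\<sigma> i) (A i)"
    and "zer (\<lambda>p. \<Sum>i\<in>UNIV. A i p) \<noteq> {}"
    and "0 < \<mu>" and "\<mu> < 2"
    and "\<And>i. \<omega> i > 0" and "(\<Sum>i\<in>UNIV. \<omega> i) = 1"
    and "nonmonotone_case \<sigma> \<omega> \<mu> bound \<or> monotone_case \<sigma> bound"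
    and "0 < \<gamma>" and "ereal \<gamma> < bound"
    and "\<And>k. z k \<in> J_F A \<omega> \<gamma> (x k)"
    and "\<And>k. y k \<in> J_G A \<omega> \<gamma> (2 *\<^sub>R z k - x k)"
    and "\<And>k. x (Suc k) = x k + \<mu> *\<^sub>R (y k - z k)"
  shows "(\<exists>xbar zbar.
            xbar \<in> Fix (DR_op A \<omega> \<gamma> \<mu>) \<and>
            weakly_tendsto x xbar \<and>
            J_F A \<omega> \<gamma> xbar = {zbar} \<and>
            zbar \<in> diag ` zer (\<lambda>p. \<Sum>i\<in>UNIV. A i p) \<and>
            (nonmonotone_case \<sigma> \<omega> \<mu> bound \<or> (monotone_case \<sigma> bound \<and> (\<exists>j. \<sigma> j > 0)) \<longrightarrow>
               z \<longlonglongrightarrow> zbar \<and> y \<longlonglongrightarrow> zbar \<and>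
               (\<exists>u. U_op A \<omega> \<gamma> xbar = {u} \<and> zer (\<lambda>p. \<Sum>i\<in>UNIV. A i p) = {u})) \<and>
            (monotone_case \<sigma> bound \<and> (\<forall>i. \<sigma> i = 0) \<longrightarrow>
               weakly_tendsto z zbar \<and> weakly_tendsto y zbar)) \<and>
         (\<exists>t. (\<forall>k. DR_op A \<omega> \<gamma> \<mu> (x k) = {t k}) \<and>
              (\<lambda>k. norm (x k - t k)) \<in> o(\<lambda>k. 1 / sqrt (real k))) \<and>
         (\<lambda>k. norm (y (Suc k) - y k)) \<in> o(\<lambda>k. 1 / sqrt (real k)) \<and>
         (\<lambda>k. norm (z (Suc k) - z k)) \<in> o(\<lambda>k. 1 / sqrt (real k))"
proof -
  note \<omega> = assms(5,6)
  note zero_iff = zero_sum_iff_fixed_splitting[where A = A, OF \<omega> \<open>0 < \<gamma>\<close>]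
  obtain s where s: "admissible \<sigma> \<omega> \<gamma> \<mu> s"
  proof (cases "nonmonotone_case \<sigma> \<omega> \<mu> bound")
    case True
    then show ?thesis
      using admissible_if_nonmonotone[of \<omega> \<gamma> \<mu> \<sigma> bound] assms(4,5,8,9) that by blast
  next
    case False
    then have "\<And>j. \<sigma> j \<ge> 0" using assms(7) by (simp add: monotone_case_def)
    then show ?thesis
      using admissible_if_monotone[of \<sigma> \<omega> \<gamma> \<mu>] \<omega> assms(4,8) that by blast
  qed
  obtain \<kappa> \<tau> where "0 < \<kappa>" "0 \<le> \<tau>" and strong: "0 < \<tau> \<or> (\<forall>j. \<sigma> j = 0)"
    and coercive: "\<And>(p :: 'a) (z :: 'a ^ 'n). \<kappa> * wsq \<omega> (diag p - z) + \<tau> * (norm p)\<^sup>2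
      \<le> \<gamma> * (\<sigma> None * (norm p)\<^sup>2 + (\<Sum>i\<in>UNIV. \<sigma> (Some i) * (norm (z $ i))\<^sup>2))
        + (1 - \<mu> / 2) * wsq \<omega> (diag p - z)"
    using admissible_coercive[OF assms(5,8,4) s] by blast
  interpret warped_DR A \<sigma> \<omega> \<gamma> \<mu> \<kappa> \<tau>
    using assms(1,3,8) \<omega> \<open>0 < \<kappa>\<close> \<open>0 \<le> \<tau>\<close> strong coercive
      admissible_resolvable[OF \<omega> assms(8,3,4) s]
    by unfold_locales
  have "\<exists>p u. y k = diag p \<and> splitting A \<omega> \<gamma> (x k) (z k) p u" for k
    using splitting_iff[OF \<omega> \<open>0 < \<gamma>\<close>] assms(10,11) by blast
  then obtain p u where y: "\<And>k. y k = diag (p k)"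
    and split: "\<And>k. splitting A \<omega> \<gamma> (x k) (z k) (p k) (u k)"
    by metis
  have zer: "q \<in> zer (\<lambda>p. \<Sum>i\<in>UNIV. A i p) \<longleftrightarrow> (\<exists>c. fixed_at c q)" for q
    unfolding zero_iff fixed_at_def ..
  interpret warped_DR_iteration A \<sigma> \<omega> \<gamma> \<mu> \<kappa> \<tau> x z p u
    using split assms(2,12) zer y by unfold_locales auto
  obtain xbar q where fixed: "fixed_at xbar q" and x: "weakly_tendsto x xbar"
    and z: "weakly_tendsto z (diag q)"
    using weak_convergence by blast
  then obtain w where w: "splitting A \<omega> \<gamma> xbar (diag q) q w" by (auto simp: fixed_at_def)
  have y_eq: "y k = z k + d k" and z_eq: "z k = y k - d k" for k by (simp_all add: y d_def)
  have y_weak: "weakly_tendsto y (diag q)"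
    using weakly_tendsto_add[OF z tendsto_imp_weakly_tendsto[OF d_tendsto_0]]
    by (simp flip: y_eq)
  \<comment> \<open>If the moduli do not all vanish, then \<open>\<tau> > 0\<close>.\<close>
  have strong_limits: "z \<longlonglongrightarrow> diag q \<and> y \<longlonglongrightarrow> diag q \<and>
      (\<exists>u. U_op A \<omega> \<gamma> xbar = {u} \<and> zer (\<lambda>p. \<Sum>i\<in>UNIV. A i p) = {u})"
    if "\<sigma> j \<noteq> 0" for j
  proof -
    have "0 < \<tau>" using strong that by blast
    have y_lim: "y \<longlonglongrightarrow> diag q"
      using p_tendsto_if_strong[OF \<open>0 < \<tau>\<close> fixed] by (intro vec_tendstoI) (simp add: y diag_def)
    then have "z \<longlonglongrightarrow> diag q"
      using tendsto_diff[OF y_lim d_tendsto_0] by (simp flip: z_eq)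
    moreover have "zer (\<lambda>p. \<Sum>i\<in>UNIV. A i p) = {q}"
      using fixed fixed_at_unique_if_strong[OF \<open>0 < \<tau>\<close>] zer by blast
    ultimately show ?thesis using y_lim U_op_at[OF w] by blast
  qed
  have "xbar \<in> Fix (DR_op A \<omega> \<gamma> \<mu>)" using DR_op_at[OF w] by (simp add: Fix_def)
  moreover have "diag q \<in> diag ` zer (\<lambda>p. \<Sum>i\<in>UNIV. A i p)" using zer fixed by blast
  moreover have "\<exists>j. \<sigma> j \<noteq> 0"
    if "nonmonotone_case \<sigma> \<omega> \<mu> bound \<or> (monotone_case \<sigma> bound \<and> (\<exists>j. \<sigma> j > 0))"
    using that by (metis less_irrefl nonmonotone_case_def)
  moreover have "DR_op A \<omega> \<gamma> \<mu> (x k) = {x (Suc k)}" for k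
    using DR_op_at[OF split] step by simp
  moreover have "(\<lambda>k. norm (y (Suc k) - y k)) \<in> o(\<lambda>k. 1 / sqrt (real k))"
    using p_rate by (simp add: y)
  ultimately show ?thesis
    using x z y_weak J_F_at[OF w] strong_limits residual_rate z_rate
    by (intro conjI exI[of _ xbar] exI[of _ "diag q"] exI[of _ "\<lambda>k. x (Suc k)"]) blast+
qed

end
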